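(* Consider the linear model $y=X\mathring{\beta}+\varepsilon$ with independent, mean-zero noise variables $\varepsilon_1,\dots,\varepsilon_n$ that are subgaussian with constant $\sigma$, i.e. $\mathbb{E}\exp(u\varepsilon_i)\le\exp(\sigma^2u^2/2)$ for all $u\in\mathbb{R}$. Assume that there exists $a$ with $0<a\le\sqrt{1-(1+\log(2\log p))/(2\log p)}$ such that $$\frac{2\sigma^2\log p}{a^4}\le\lambda^2<\frac{(\zeta_a^2\,\mathring{\beta}_{min}^2)\wedge\delta}{4(1+a)^2}.$$ Then $$\mathbb{P}(\hat T_{SS}\ne T)\le5\exp\left(-\frac{a^2(1-a^2)\lambda^2}{2\sigma^2}\right).$$
   Context: Notation: $a\wedge b=\min(a,b)$; $\|\cdot\|$ is the Euclidean norm, $|\nu|_1=\sum_j|\nu_j|$, $|\nu|_\infty=\max_j|\nu_j|$; $|J|$ is the cardinality of $J$. $X=[x_{.1},\dots,x_{.p}]$ is a fixed $n\times p$ matrix with columns satisfying $\|x_{.j}\|=1$, $\mathring{\beta}\in\mathbb{R}^p$ is the true vector, $T=\{j:\mathring{\beta}_j\ne0\}$ (nonempty), $t=|T|<n\wedge p$, $\bar T=\{1,\dots,p\}\setminus T$, $\mathring{\beta}_{min}=\min_{j\in T}|\mathring{\beta}_j|$. For $J\subseteq\{1,\dots,p\}$, $\beta_J$ is the subvector with indices in $J$ (identified also with the vector that is zero outside $J$), $X_J$ the submatrix of columns in $J$, $H_J$ the orthogonal projection onto the column span of $X_J$. Put $$\delta_k=\min_{J\subset T,\,|T\setminus J|=k}\|(I-H_J)X_T\mathring{\beta}_T\|^2,\quad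 k=1,\dots,t-1,\qquad \delta=\min_{k=1,\dots,t-1}\delta_k/k$$ ($\delta=+\infty$ if $t=1$). For $a\in(0,1)$, $$\mathcal{C}_a=\Big\{\nu\in\mathbb{R}^p:|\nu_{\bar T}|_1\le\tfrac{1+a}{1-a}|\nu_T|_1,\ \nu_jx_{.j}^TX\nu\le0\ \text{for } j\in\bar T\Big\},\qquad \zeta_a=\inf_{0\ne\nu\in\mathcal{C}_a}\frac{|X^TX\nu|_\infty}{|\nu|_\infty}.$$ Loss: $\ell(\beta)=\tfrac12\|X\beta\|^2-\beta^TX^Ty$. Screening–Selection (SS) algorithm with parameter $\lambda>0$: compute the Lasso estimator $\hat\beta=\mathrm{argmin}_\beta\{\ell(\beta)+\lambda|\beta|_1\}$; order its nonzero coordinates $|\hat\beta_{j_1}|\ge\dots\ge|\hat\beta_{j_s}|$, $s=|\mathrm{supp}\,\hat\beta|$; let $\mathcal{J}=\{\{j_1\},\{j_1,j_2\},\dots,\mathrm{supp}\,\hat\beta\}$; output $\hat T_{SS}=\mathrm{argmin}_{J\in\mathcal{J}}\{\ell_J+\tfrac{\lambda^2}{2}|J|\}$, where $\ell_J=\min_{\beta_J}\ell(\beta_J)$ is the minimal loss over vectors supported in $J$. (If $\hat\beta=0$, $\hat T_{SS}=\emptyset$.) *)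

theory Defs
  imports "HOL-Probability.Probability"
begin

text \<open>
  The design matrix is \<open>X :: real^'p^'n\<close> (\<open>n\<close> rows, \<open>p\<close> columns), so that \<open>n = CARD('n)\<close> and
  \<open>p = CARD('p)\<close>; index sets are subsets of the type \<open>'p\<close>, and \<open>column j X\<close> is the vector
  \<open>x\<^sub>.\<^sub>j\<close>.  A subvector \<open>\<beta>\<^sub>J\<close> is identified with the vector that agrees with \<open>\<beta>\<close> on \<open>J\<close> and
  vanishes outside \<open>J\<close>, so \<open>X\<^sub>J \<beta>\<^sub>J\<close> is \<open>X *v restrict_vec J \<beta>\<close>.
\<close>

definition supp_vec :: "real^'p \<Rightarrow> 'p set" where
  "supp_vec b = {j. b $ j \<noteq> 0}"

definition restrict_vec :: "'p set \<Rightarrow> real^'p \<Rightarrow> real^'p" where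
  "restrict_vec J b = (\<chi> j. if j \<in> J then b $ j else 0)"

definition l1norm :: "real^'p \<Rightarrow> real" where
  "l1norm v = (\<Sum>j\<in>UNIV. \<bar>v $ j\<bar>)"

text \<open>Orthogonal projection onto the column span of \<open>X\<^sub>J\<close>; it is well defined even when the
  columns in \<open>J\<close> are linearly dependent.\<close>

definition proj_cols :: "real^'p^'n \<Rightarrow> 'p set \<Rightarrow> real^'n \<Rightarrow> real^'n" where
  "proj_cols X J v = (THE z. z \<in> span ((\<lambda>j. column j X) ` J) \<and>
     (\<forall>w\<in>span ((\<lambda>j. column j X) ` J). orthogonal (v - z) w))"

lemma proj_cols_unique:
  fixes X :: "real^'p^'n"
  shows "\<exists>!z. z \<in> span ((\<lambda>j. column j X) ` J) \<and>
     (\<forall>w\<in>span ((\<lambda>j. column j X) ` J). orthogonal (v - z) w)"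
proof (rule ex_ex1I)
  let ?S = "(\<lambda>j. column j X) ` J"
  obtain y z where "y \<in> span ?S" "\<And>w. w \<in> span ?S \<Longrightarrow> orthogonal z w" "v = y + z"
    using orthogonal_subspace_decomp_exists by blast
  then show "\<exists>z. z \<in> span ?S \<and> (\<forall>w\<in>span ?S. orthogonal (v - z) w)"
    by auto
next
  let ?S = "(\<lambda>j. column j X) ` J"
  fix z z'
  assume z: "z \<in> span ?S \<and> (\<forall>w\<in>span ?S. orthogonal (v - z) w)"
    and z': "z' \<in> span ?S \<and> (\<forall>w\<in>span ?S. orthogonal (v - z') w)"
  then have "z - z' \<in> span ?S"
    by (simp add: span_diff)
  with z z' have "(v - z) \<bullet> (z - z') = 0" "(v - z') \<bullet> (z - z') = 0"
    by (auto simp: orthogonal_def)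
  then have "(z - z') \<bullet> (z - z') = 0"
    by (simp add: inner_diff_left)
  then show "z = z'"
    by simp
qed

definition delta_k :: "real^'p^'n \<Rightarrow> real^'p \<Rightarrow> nat \<Rightarrow> real" where
  "delta_k X b k = (let T = supp_vec b; m = X *v restrict_vec T b in
     Min {(norm (m - proj_cols X J m))\<^sup>2 | J. J \<subset> T \<and> card (T - J) = k})"

text \<open>Extended-real valued: the infimum over the empty range, i.e. for \<open>card (supp_vec b) = 1\<close>,
  is \<open>\<infinity>\<close>.\<close>

definition delta :: "real^'p^'n \<Rightarrow> real^'p \<Rightarrow> ereal" where
  "delta X b = (INF k\<in>{1..<card (supp_vec b)}. ereal (delta_k X b k / real k))"

definition beta_min :: "real^'p \<Rightarrow> real" where
  "beta_min b = Min ((\<lambda>j. \<bar>b $ j\<bar>) ` supp_vec b)"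

definition sign_cone :: "real^'p^'n \<Rightarrow> 'p set \<Rightarrow> real \<Rightarrow> (real^'p) set" where
  "sign_cone X T a =
     {v. l1norm (restrict_vec (- T) v) \<le> (1 + a) / (1 - a) * l1norm (restrict_vec T v) \<and>
         (\<forall>j\<in>- T. v $ j * (column j X \<bullet> (X *v v)) \<le> 0)}"

text \<open>The infimum of a nonempty set of nonnegative reals whenever \<open>T\<close> is nonempty and \<open>0 < a < 1\<close>:
  the coordinate vectors indexed by \<open>T\<close> lie in the cone.\<close>

definition zeta :: "real^'p^'n \<Rightarrow> 'p set \<Rightarrow> real \<Rightarrow> real" where
  "zeta X T a =
     (INF v\<in>sign_cone X T a - {0}. infnorm (transpose X *v (X *v v)) / infnorm v)"

definition loss :: "real^'p^'n \<Rightarrow> real^'n \<Rightarrow> real^'p \<Rightarrow> real" where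
  "loss X y b = (norm (X *v b))\<^sup>2 / 2 - b \<bullet> (transpose X *v y)"

definition is_lasso :: "real^'p^'n \<Rightarrow> real^'n \<Rightarrow> real \<Rightarrow> real^'p \<Rightarrow> bool" where
  "is_lasso X y lam b \<longleftrightarrow> is_arg_min (\<lambda>b. loss X y b + lam * l1norm b) (\<lambda>_. True) b"

text \<open>The loss is bounded below by \<open>- (norm y)\<^sup>2 / 2\<close>, and the infimum is attained.\<close>

definition min_loss :: "real^'p^'n \<Rightarrow> real^'n \<Rightarrow> 'p set \<Rightarrow> real" where
  "min_loss X y J = (INF b\<in>{b. supp_vec b \<subseteq> J}. loss X y b)"

definition decreasing_order :: "real^'p \<Rightarrow> 'p list \<Rightarrow> bool" where
  "decreasing_order b js \<longleftrightarrow> distinct js \<and> set js = supp_vec b \<and>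
     sorted_wrt (\<lambda>i j. \<bar>b $ i\<bar> \<ge> \<bar>b $ j\<bar>) js"

definition nested_family :: "'p list \<Rightarrow> 'p set set" where
  "nested_family js = {set (take k js) | k. 1 \<le> k \<and> k \<le> length js}"

text \<open>\<open>ss_output X y lam S\<close>: the Screening--Selection algorithm on data \<open>y\<close> may return \<open>S\<close>.  A
  relation is used because a Lasso minimiser, an ordering of coordinates of equal modulus and a
  minimiser of the selection criterion need not be unique; every way of resolving such ties is
  admitted.\<close>

definition ss_output :: "real^'p^'n \<Rightarrow> real^'n \<Rightarrow> real \<Rightarrow> 'p set \<Rightarrow> bool" where
  "ss_output X y lam S \<longleftrightarrow> (\<exists>b js. is_lasso X y lam b \<and> decreasing_order b js \<and>
     (if b = 0 then S = {}
      else is_arg_min (\<lambda>J. min_loss X y J + lam\<^sup>2 / 2 * real (card J))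
             (\<lambda>J. J \<in> nested_family js) S))"

text \<open>Integrability of the exponential moments is required explicitly, since the Bochner integral
  of a non-integrable function is \<open>0\<close>.\<close>

definition subgaussian :: "'w measure \<Rightarrow> real \<Rightarrow> ('w \<Rightarrow> real) \<Rightarrow> bool" where
  "subgaussian M \<sigma> Z \<longleftrightarrow>
     (\<forall>u. integrable M (\<lambda>w. exp (u * Z w)) \<and>
          (\<integral>w. exp (u * Z w) \<partial>M) \<le> exp (\<sigma>\<^sup>2 * u\<^sup>2 / 2))"

end

theory Submission
  imports Defs
begin

text \<open>
The algorithm can fail in three ways, and each needs the noise \<open>\<epsilon>\<close> to be exceptionally large in
some prescribed direction or subspace.

\<^emph>\<open>Screening.\<close>  If \<open>\<bar>column j X \<bullet> \<epsilon>\<bar> \<le> a * lam\<close> for all \<open>j\<close>, then the stationarity conditions of the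
Lasso put its error into the sign-restricted cone (\<open>lasso_error_in_sign_cone\<close>), and the definition
of \<open>zeta\<close> with the upper bound on \<open>lam\<close> make every coordinate of the error smaller than half the
minimal signal (\<open>lasso_error_lt_half_beta_min\<close>).  Ordering by modulus then lists the true support
\<open>T\<close> first: \<open>T\<close> is a candidate, and every other candidate is a proper nonempty subset or a proper
superset of it.

\<^emph>\<open>Underfitting.\<close>  The criterion can prefer \<open>T - D\<close> to \<open>T\<close> only if the noise offsets the
part of the signal that the columns in \<open>T - D\<close> do not explain, whose squared length is at least
\<open>card D\<close> times \<open>delta\<close>.  This is a deviation of a single linear form (\<open>underfit_forces_large_linear_noise\<close>) and has probability at most
\<open>r ^ card D\<close> with \<open>r = exp (- a\<^sup>2 * \<tau> / 2)\<close>, where \<open>\<tau> = lam\<^sup>2 / \<sigma>\<^sup>2\<close>.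

\<^emph>\<open>Overfitting.\<close>  The criterion can prefer \<open>T \<union> D\<close> to \<open>T\<close> only if the projection of the noise onto
a subspace of dimension at most \<open>card D\<close> has squared length at least \<open>card D * lam\<^sup>2\<close>.  A chi-square
type tail bound for subgaussian vectors (\<open>subgaussian_vector_squares_tail\<close>), proved by integrating
against an auxiliary Gaussian variable, gives probability at most \<open>r' ^ card D\<close> with
\<open>r' = exp (- (\<tau> - 1 - ln \<tau>) / 2)\<close>.

The conditions on \<open>a\<close> and the lower bound on \<open>lam\<close> imply \<open>p * r \<le> q\<close> and \<open>p * r' \<le> q\<close> for
\<open>q = exp (- a\<^sup>2 * (1 - a\<^sup>2) * \<tau> / 2)\<close> (\<open>tuning_parameter_consequences\<close>).  The union bound over the
\<open>2 * p\<close> signed columns costs \<open>2 * q\<close>.  For each of the other two failures, summing over all nonempty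
\<open>D\<close> costs at most \<open>(1 + q / p) ^ p - 1 \<le> exp q - 1\<close>.  The total \<open>2 * q + 2 * (exp q - 1)\<close> is at most
\<open>5 * q\<close> when \<open>q \<le> 1 / 5\<close>, and otherwise \<open>5 * q\<close> exceeds \<open>1\<close>.
\<close>

section \<open>Subgaussian random vectors\<close>

text \<open>Stated with the integral of nonnegative functions, so that no integrability has to be
carried along and Tonelli's theorem applies directly.\<close>

definition subgaussian_vector :: "'w measure \<Rightarrow> real \<Rightarrow> ('w \<Rightarrow> 'a::euclidean_space) \<Rightarrow> bool" where
  "subgaussian_vector M \<sigma> Z \<longleftrightarrow> Z \<in> borel_measurable M \<and>
     (\<forall>u. (\<integral>\<^sup>+w. ennreal (exp (u \<bullet> Z w)) \<partial>M) \<le> ennreal (exp (\<sigma>\<^sup>2 * (norm u)\<^sup>2 / 2)))"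

text \<open>Independence turns the exponential moment of \<open>u \<bullet> Z\<close> into the product of the exponential
moments of the summands \<open>u $ i * Z $ i\<close>, and the exponents \<open>\<sigma>\<^sup>2 * (u $ i)\<^sup>2 / 2\<close> add up.\<close>

lemma (in prob_space) subgaussian_vector_of_indep_coordinates:
  fixes Z :: "'a \<Rightarrow> real^'n"
  assumes indep: "indep_vars (\<lambda>_. borel) (\<lambda>i w. Z w $ i) UNIV"
    and sg: "\<And>i. subgaussian M \<sigma> (\<lambda>w. Z w $ i)"
  shows "subgaussian_vector M \<sigma> Z"
  unfolding subgaussian_vector_def
proof (intro conjI allI)
  have meas: "(\<lambda>w. Z w $ i) \<in> borel_measurable M" for i
    using indep by (auto simp: indep_vars_def)
  then show "Z \<in> borel_measurable M"
    by (subst borel_measurable_euclidean_space) (auto simp: Basis_vec_def inner_axis)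
  fix u :: "real^'n"
  have "indep_vars (\<lambda>_. borel) (\<lambda>i w. ennreal (exp (u $ i * Z w $ i))) UNIV"
    by (rule indep_vars_compose2[OF indep, of "\<lambda>i x. ennreal (exp (u $ i * x))"]) measurable
  then have "(\<integral>\<^sup>+w. (\<Prod>i\<in>UNIV. ennreal (exp (u $ i * Z w $ i))) \<partial>M)
      = (\<Prod>i\<in>UNIV. \<integral>\<^sup>+w. ennreal (exp (u $ i * Z w $ i)) \<partial>M)"
    by (intro indep_vars_nn_integral) auto
  also have "\<dots> \<le> (\<Prod>i\<in>UNIV. ennreal (exp (\<sigma>\<^sup>2 * (u $ i)\<^sup>2 / 2)))"
  proof (rule prod_mono_ennreal)
    fix i
    have "(\<integral>\<^sup>+w. ennreal (exp (u $ i * Z w $ i)) \<partial>M)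
        = ennreal (\<integral>w. exp (u $ i * Z w $ i) \<partial>M)"
      using sg[of i] by (intro nn_integral_eq_integral) (auto simp: subgaussian_def)
    also have "\<dots> \<le> ennreal (exp (\<sigma>\<^sup>2 * (u $ i)\<^sup>2 / 2))"
      using sg[of i] by (intro ennreal_leI) (auto simp: subgaussian_def)
    finally show "(\<integral>\<^sup>+w. ennreal (exp (u $ i * Z w $ i)) \<partial>M) \<le> ennreal (exp (\<sigma>\<^sup>2 * (u $ i)\<^sup>2 / 2))" .
  qed
  also have "\<dots> = ennreal (exp (\<Sum>i\<in>UNIV. \<sigma>\<^sup>2 * (u $ i)\<^sup>2 / 2))"
    by (simp add: prod_ennreal exp_sum)
  also have "(\<Sum>i\<in>UNIV. \<sigma>\<^sup>2 * (u $ i)\<^sup>2 / 2) = \<sigma>\<^sup>2 * (norm u)\<^sup>2 / 2"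
    unfolding power2_norm_eq_inner
    by (simp add: inner_vec_def sum_distrib_left sum_divide_distrib power2_eq_square)
  also have "(\<lambda>w. \<Prod>i\<in>UNIV. ennreal (exp (u $ i * Z w $ i))) = (\<lambda>w. ennreal (exp (u \<bullet> Z w)))"
    by (simp add: prod_ennreal exp_sum inner_vec_def)
  finally show "(\<integral>\<^sup>+w. ennreal (exp (u \<bullet> Z w)) \<partial>M) \<le> ennreal (exp (\<sigma>\<^sup>2 * (norm u)\<^sup>2 / 2))" .
qed

text \<open>Chernoff's bound for \<open>c * (u \<bullet> Z)\<close>.\<close>

lemma subgaussian_vector_linear_tail:
  assumes sg: "subgaussian_vector M \<sigma> Z" and "\<sigma> > 0" "s > 0" "u \<noteq> 0"
  shows "emeasure M {w \<in> space M. norm u * s \<le> u \<bullet> Z w} \<le> ennreal (exp (- s\<^sup>2 / (2 * \<sigma>\<^sup>2)))"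
proof -
  have [measurable]: "Z \<in> borel_measurable M"
    using sg by (simp add: subgaussian_vector_def)
  \<comment> \<open>The minimiser of \<open>- c * (norm u * s) + \<sigma>\<^sup>2 * c\<^sup>2 * (norm u)\<^sup>2 / 2\<close>.\<close>
  define c where "c = s / (\<sigma>\<^sup>2 * norm u)"
  have c: "c > 0" using assms by (simp add: c_def)
  have "emeasure M {w \<in> space M. u \<bullet> Z w \<ge> norm u * s}
      \<le> ennreal (exp (- c * (norm u * s))) *
        nn_integral M (\<lambda>w. ennreal (exp (c * (u \<bullet> Z w))) * indicator (space M) w)"
    by (rule Chernoff_ineq_nn_integral_ge[OF c]) auto
  also have "nn_integral M (\<lambda>w. ennreal (exp (c * (u \<bullet> Z w))) * indicator (space M) w)
      = (\<integral>\<^sup>+w. ennreal (exp ((c *\<^sub>R u) \<bullet> Z w)) \<partial>M)"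
    by (intro nn_integral_cong) (simp)
  also have "\<dots> \<le> ennreal (exp (\<sigma>\<^sup>2 * (norm (c *\<^sub>R u))\<^sup>2 / 2))"
    using sg unfolding subgaussian_vector_def by blast
  also have "ennreal (exp (- c * (norm u * s))) * ennreal (exp (\<sigma>\<^sup>2 * (norm (c *\<^sub>R u))\<^sup>2 / 2))
      = ennreal (exp (- c * (norm u * s) + \<sigma>\<^sup>2 * (norm (c *\<^sub>R u))\<^sup>2 / 2))"
    by (simp only: exp_add ennreal_mult'' exp_ge_zero)
  also have "- c * (norm u * s) + \<sigma>\<^sup>2 * (norm (c *\<^sub>R u))\<^sup>2 / 2 = - s\<^sup>2 / (2 * \<sigma>\<^sup>2)"
    using assms by (simp add: c_def power_mult_distrib power_divide field_simps)
      (simp add: power2_eq_square)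
  finally show ?thesis by (simp add: mult_left_mono)
qed

lemma nn_integral_std_normal_exp_linear:
  "(\<integral>\<^sup>+g. ennreal (std_normal_density g * exp (c * g)) \<partial>lborel) = ennreal (exp (c\<^sup>2 / 2))"
proof -
  have "std_normal_density g * exp (c * g) = exp (c\<^sup>2 / 2) * normal_density c 1 g" for g
    by (simp add: normal_density_def exp_add[symmetric] field_simps power2_eq_square)
  then have "(\<integral>\<^sup>+g. ennreal (std_normal_density g * exp (c * g)) \<partial>lborel)
     = (\<integral>\<^sup>+g. ennreal (exp (c\<^sup>2 / 2)) * ennreal (normal_density c 1 g) \<partial>lborel)"
    by (simp add: ennreal_mult)
  also have "\<dots> = ennreal (exp (c\<^sup>2 / 2)) * (\<integral>\<^sup>+g. ennreal (normal_density c 1 g) \<partial>lborel)"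
    by (rule nn_integral_cmult) auto
  also have "(\<integral>\<^sup>+g. ennreal (normal_density c 1 g) \<partial>lborel) = 1"
    by (subst nn_integral_eq_integral) auto
  finally show ?thesis by simp
qed

lemma nn_integral_std_normal_exp_square:
  assumes "c < 1"
  shows "(\<integral>\<^sup>+g. ennreal (std_normal_density g * exp (c * g\<^sup>2 / 2)) \<partial>lborel)
    = ennreal (1 / sqrt (1 - c))"
proof -
  define s where "s = 1 / sqrt (1 - c)"
  have s: "s > 0" "s\<^sup>2 = 1 / (1 - c)" using assms by (auto simp: s_def power_divide)
  have "std_normal_density g * exp (c * g\<^sup>2 / 2) = s * normal_density 0 s g" for g
  proof -
    have "sqrt (2 * pi * s\<^sup>2) = sqrt (2 * pi) * s"
      using s(1) by (simp only: real_sqrt_mult real_sqrt_abs abs_of_pos)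
    moreover have "- g\<^sup>2 / 2 + c * g\<^sup>2 / 2 = - g\<^sup>2 / (2 * s\<^sup>2)"
      using assms by (simp add: s field_simps)
    ultimately show ?thesis
      using s(1) by (simp add: normal_density_def exp_add[symmetric])
  qed
  then have "(\<integral>\<^sup>+g. ennreal (std_normal_density g * exp (c * g\<^sup>2 / 2)) \<partial>lborel)
     = (\<integral>\<^sup>+g. ennreal s * ennreal (normal_density 0 s g) \<partial>lborel)"
    using s by (simp add: ennreal_mult)
  also have "\<dots> = ennreal s * (\<integral>\<^sup>+g. ennreal (normal_density 0 s g) \<partial>lborel)"
    by (rule nn_integral_cmult) auto
  also have "(\<integral>\<^sup>+g. ennreal (normal_density 0 s g) \<partial>lborel) = 1"
    using s by (subst nn_integral_eq_integral) auto
  finally show ?thesis by (simp add: s_def)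
qed

text \<open>The square of a linear form is linearised by an auxiliary Gaussian variable \<open>g\<close>:
\<open>exp (s * (q \<bullet> Z)\<^sup>2 / 2)\<close> is the average of \<open>exp (sqrt s * g * (q \<bullet> Z))\<close> over \<open>g\<close>.  After
exchanging the two integrals, the subgaussian bound applies to a linear form, and the remaining
integral over \<open>g\<close> is that of \<open>exp (\<sigma>\<^sup>2 * s * g\<^sup>2 / 2)\<close>.  One direction \<open>q\<close> is treated at a time,
and the linear part \<open>u\<close>, orthogonal to all directions still present, is there to make the
induction work: the step moves \<open>u\<close> to \<open>u + (sqrt s * g) *\<^sub>R q\<close>.\<close>

lemma (in sigma_finite_measure) subgaussian_vector_exp_squares:
  fixes Z :: "'a \<Rightarrow> 'b::euclidean_space"
  assumes sg: "subgaussian_vector M \<sigma> Z" and s: "0 \<le> s" "\<sigma>\<^sup>2 * s < 1"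
    and "finite B" "pairwise orthogonal B" "\<And>q. q \<in> B \<Longrightarrow> norm q = 1"
    and "\<And>q. q \<in> B \<Longrightarrow> orthogonal u q"
  shows "(\<integral>\<^sup>+w. ennreal (exp (u \<bullet> Z w + s / 2 * (\<Sum>q\<in>B. (q \<bullet> Z w)\<^sup>2))) \<partial>M)
    \<le> ennreal ((1 / sqrt (1 - \<sigma>\<^sup>2 * s)) ^ card B * exp (\<sigma>\<^sup>2 * (norm u)\<^sup>2 / 2))"
  using assms(4-)
proof (induction B arbitrary: u rule: finite_induct)
  case empty
  then show ?case using sg by (simp add: subgaussian_vector_def)
next
  case (insert q B)
  have [measurable]: "Z \<in> borel_measurable M"
    using sg by (simp add: subgaussian_vector_def)
  define K where "K = (1 / sqrt (1 - \<sigma>\<^sup>2 * s)) ^ card B"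
  have K: "K \<ge> 0" unfolding K_def using s by simp
  define R where "R w = u \<bullet> Z w + s / 2 * (\<Sum>q\<in>B. (q \<bullet> Z w)\<^sup>2)" for w
  have [measurable]: "R \<in> borel_measurable M" unfolding R_def by measurable
  interpret P: pair_sigma_finite lborel M ..
  have uq: "u \<bullet> q = 0" and nq: "norm q = 1"
    using insert.prems by (auto simp: orthogonal_def)
  have step: "(\<integral>\<^sup>+w. ennreal (exp ((u + (sqrt s * g) *\<^sub>R q) \<bullet> Z w + s / 2 * (\<Sum>q\<in>B. (q \<bullet> Z w)\<^sup>2))) \<partial>M)
      \<le> ennreal (K * exp (\<sigma>\<^sup>2 * (norm (u + (sqrt s * g) *\<^sub>R q))\<^sup>2 / 2))" for g
    unfolding K_def
  proof (rule insert.IH)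
    show "pairwise orthogonal B"
      using insert.prems by (auto simp: pairwise_insert)
    show "norm q' = 1" if "q' \<in> B" for q'
      using insert.prems that by auto
    show "orthogonal (u + (sqrt s * g) *\<^sub>R q) q'" if "q' \<in> B" for q'
      using insert.prems insert.hyps that
      by (auto simp: pairwise_insert orthogonal_def inner_add_left)
  qed
  have "(\<integral>\<^sup>+w. ennreal (exp (u \<bullet> Z w + s / 2 * (\<Sum>q\<in>insert q B. (q \<bullet> Z w)\<^sup>2))) \<partial>M)
     = (\<integral>\<^sup>+w. (\<integral>\<^sup>+g. ennreal (std_normal_density g * exp (R w + sqrt s * g * (q \<bullet> Z w))) \<partial>lborel) \<partial>M)"
  proof (rule nn_integral_cong)
    fix w
    have "(\<integral>\<^sup>+g. ennreal (std_normal_density g * exp (R w + sqrt s * g * (q \<bullet> Z w))) \<partial>lborel)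
       = (\<integral>\<^sup>+g. ennreal (exp (R w)) *
            ennreal (std_normal_density g * exp ((sqrt s * (q \<bullet> Z w)) * g)) \<partial>lborel)"
      by (intro nn_integral_cong) (simp add: ennreal_mult[symmetric] exp_add mult_ac)
    also have "\<dots> = ennreal (exp (R w)) * ennreal (exp ((sqrt s * (q \<bullet> Z w))\<^sup>2 / 2))"
      by (subst nn_integral_cmult) (simp_all add: nn_integral_std_normal_exp_linear)
    also have "\<dots> = ennreal (exp (R w + (sqrt s * (q \<bullet> Z w))\<^sup>2 / 2))"
      by (simp add: exp_add ennreal_mult)
    also have "R w + (sqrt s * (q \<bullet> Z w))\<^sup>2 / 2 =
        u \<bullet> Z w + s / 2 * (\<Sum>q\<in>insert q B. (q \<bullet> Z w)\<^sup>2)"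
      using insert.hyps s by (simp add: R_def power_mult_distrib algebra_simps)
    finally show "ennreal (exp (u \<bullet> Z w + s / 2 * (\<Sum>q\<in>insert q B. (q \<bullet> Z w)\<^sup>2))) =
        (\<integral>\<^sup>+g. ennreal (std_normal_density g * exp (R w + sqrt s * g * (q \<bullet> Z w))) \<partial>lborel)" ..
  qed
  also have "\<dots> = (\<integral>\<^sup>+g. (\<integral>\<^sup>+w.
      ennreal (std_normal_density g * exp (R w + sqrt s * g * (q \<bullet> Z w))) \<partial>M) \<partial>lborel)"
    by (rule P.Fubini') measurable
  also have "\<dots> \<le> (\<integral>\<^sup>+g. ennreal (K * exp (\<sigma>\<^sup>2 * (norm u)\<^sup>2 / 2)) *
      ennreal (std_normal_density g * exp ((\<sigma>\<^sup>2 * s) * g\<^sup>2 / 2)) \<partial>lborel)"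
  proof (rule nn_integral_mono)
    fix g
    have "(\<integral>\<^sup>+w. ennreal (std_normal_density g * exp (R w + sqrt s * g * (q \<bullet> Z w))) \<partial>M)
      = ennreal (std_normal_density g) * (\<integral>\<^sup>+w. ennreal (exp (R w + sqrt s * g * (q \<bullet> Z w))) \<partial>M)"
      by (subst nn_integral_cmult[symmetric]) (auto simp: ennreal_mult)
    also have "(\<integral>\<^sup>+w. ennreal (exp (R w + sqrt s * g * (q \<bullet> Z w))) \<partial>M)
       = (\<integral>\<^sup>+w. ennreal (exp ((u + (sqrt s * g) *\<^sub>R q) \<bullet> Z w + s / 2 * (\<Sum>q\<in>B. (q \<bullet> Z w)\<^sup>2))) \<partial>M)"
      by (simp add: R_def inner_add_left add_ac)
    also note step[of g]
    also have "(norm (u + (sqrt s * g) *\<^sub>R q))\<^sup>2 = (norm u)\<^sup>2 + s * g\<^sup>2"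
      using s uq nq unfolding power2_norm_eq_inner norm_eq_1
      by (simp add: inner_add_left inner_add_right inner_commute power2_eq_square)
    also have "ennreal (std_normal_density g) * ennreal (K * exp (\<sigma>\<^sup>2 * ((norm u)\<^sup>2 + s * g\<^sup>2) / 2))
        = ennreal (K * exp (\<sigma>\<^sup>2 * (norm u)\<^sup>2 / 2)) *
          ennreal (std_normal_density g * exp ((\<sigma>\<^sup>2 * s) * g\<^sup>2 / 2))"
      using K by (simp add: ennreal_mult[symmetric] exp_add[symmetric] algebra_simps add_divide_distrib)
    finally show "(\<integral>\<^sup>+w. ennreal (std_normal_density g * exp (R w + sqrt s * g * (q \<bullet> Z w))) \<partial>M)
       \<le> ennreal (K * exp (\<sigma>\<^sup>2 * (norm u)\<^sup>2 / 2)) *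
          ennreal (std_normal_density g * exp ((\<sigma>\<^sup>2 * s) * g\<^sup>2 / 2))"
      by (simp add: mult_left_mono)
  qed
  also have "\<dots> = ennreal (K * exp (\<sigma>\<^sup>2 * (norm u)\<^sup>2 / 2)) * ennreal (1 / sqrt (1 - \<sigma>\<^sup>2 * s))"
    using s by (subst nn_integral_cmult) (simp_all add: nn_integral_std_normal_exp_square)
  also have "\<dots> = ennreal ((1 / sqrt (1 - \<sigma>\<^sup>2 * s)) ^ card (insert q B) * exp (\<sigma>\<^sup>2 * (norm u)\<^sup>2 / 2))"
    using insert.hyps K s by (simp add: K_def ennreal_mult[symmetric] mult_ac)
  finally show ?case .
qed

text \<open>Chernoff's bound with the exponential moment just computed.  The result is the bound that the same
argument gives for a chi-square variable with \<open>m\<close> degrees of freedom.\<close>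

lemma (in sigma_finite_measure) subgaussian_vector_squares_tail:
  fixes Z :: "'a \<Rightarrow> 'b::euclidean_space"
  assumes sg: "subgaussian_vector M \<sigma> Z" and "\<sigma> > 0" and \<tau>: "\<tau> > 1"
    and B: "finite B" "pairwise orthogonal B" "\<And>q. q \<in> B \<Longrightarrow> norm q = 1" and "card B \<le> m"
  shows "emeasure M {w \<in> space M. real m * (\<sigma>\<^sup>2 * \<tau>) \<le> (\<Sum>q\<in>B. (q \<bullet> Z w)\<^sup>2)}
    \<le> ennreal (exp (- (\<tau> - 1 - ln \<tau>) / 2) ^ m)"
proof -
  have [measurable]: "Z \<in> borel_measurable M"
    using sg by (simp add: subgaussian_vector_def)
  \<comment> \<open>The minimiser of \<open>- s * \<sigma>\<^sup>2 * \<tau> / 2 - ln (1 - \<sigma>\<^sup>2 * s) / 2\<close>.\<close>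
  define s where "s = (1 - 1 / \<tau>) / \<sigma>\<^sup>2"
  have s: "s > 0" "\<sigma>\<^sup>2 * s = 1 - 1 / \<tau>" using assms by (auto simp: s_def)
  have s2: "s / 2 > 0" using s by simp
  have root: "1 / sqrt (1 - \<sigma>\<^sup>2 * s) = exp (ln \<tau> / 2)"
    using \<tau> by (simp add: s real_sqrt_divide flip: ln_sqrt)
  have "emeasure M {w \<in> space M. (\<Sum>q\<in>B. (q \<bullet> Z w)\<^sup>2) \<ge> real m * (\<sigma>\<^sup>2 * \<tau>)}
      \<le> ennreal (exp (- (s / 2) * (real m * (\<sigma>\<^sup>2 * \<tau>)))) *
        nn_integral M (\<lambda>w. ennreal (exp (s / 2 * (\<Sum>q\<in>B. (q \<bullet> Z w)\<^sup>2))) * indicator (space M) w)"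
    by (rule Chernoff_ineq_nn_integral_ge[OF s2]) auto
  also have "nn_integral M (\<lambda>w. ennreal (exp (s / 2 * (\<Sum>q\<in>B. (q \<bullet> Z w)\<^sup>2))) * indicator (space M) w)
     = (\<integral>\<^sup>+w. ennreal (exp (0 \<bullet> Z w + s / 2 * (\<Sum>q\<in>B. (q \<bullet> Z w)\<^sup>2))) \<partial>M)"
    by (intro nn_integral_cong) simp
  also have "\<dots> \<le> ennreal ((1 / sqrt (1 - \<sigma>\<^sup>2 * s)) ^ card B * exp (\<sigma>\<^sup>2 * (norm (0::'b))\<^sup>2 / 2))"
    using s \<tau> B by (intro subgaussian_vector_exp_squares[OF sg]) (auto simp: orthogonal_def)
  also have "\<dots> \<le> ennreal (exp (ln \<tau> / 2) ^ m)"
    unfolding root using \<tau> \<open>card B \<le> m\<close> by (intro ennreal_leI) (simp add: power_increasing)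
  also have "ennreal (exp (- (s / 2) * (real m * (\<sigma>\<^sup>2 * \<tau>)))) * ennreal (exp (ln \<tau> / 2) ^ m)
     = ennreal (exp (- (s / 2) * (real m * (\<sigma>\<^sup>2 * \<tau>)) + real m * (ln \<tau> / 2)))"
    unfolding exp_add exp_of_nat_mult by (rule ennreal_mult[symmetric]) auto
  also have "- (s / 2) * (real m * (\<sigma>\<^sup>2 * \<tau>)) + real m * (ln \<tau> / 2)
     = real m * (- (\<tau> - 1 - ln \<tau>) / 2)"
  proof -
    have "(s / 2) * (real m * (\<sigma>\<^sup>2 * \<tau>)) = real m * ((\<sigma>\<^sup>2 * s) * \<tau>) / 2" by simp
    also have "(\<sigma>\<^sup>2 * s) * \<tau> = \<tau> - 1" using \<tau> unfolding s(2) by (simp add: field_simps)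
    finally show ?thesis by (simp add: field_simps)
  qed
  finally show ?thesis by (simp only: exp_of_nat_mult mult_left_mono zero_le)
qed

text \<open>The union bound over all sets of wrong coordinates needs no binomial coefficients: the sum over
all subsets is \<open>(1 + r) ^ card A\<close>.\<close>

lemma sum_nonempty_subsets_power_le:
  fixes r :: real
  assumes "finite A" "r \<ge> 0"
  shows "(\<Sum>D\<in>Pow A - {{}}. r ^ card D) \<le> exp (real (card A) * r) - 1"
proof -
  have "(\<Sum>D\<in>Pow A. r ^ card D) = (\<Prod>x\<in>A. r + 1)"
    using assms by (subst prod_add) auto
  also have "\<dots> = (1 + r) ^ card A" by (simp add: add.commute)
  also have "\<dots> \<le> exp r ^ card A" using assms by (intro power_mono) auto
  also have "\<dots> = exp (real (card A) * r)" by (simp add: exp_of_nat_mult)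
  finally have "(\<Sum>D\<in>Pow A. r ^ card D) \<le> exp (real (card A) * r)" .
  moreover have "(\<Sum>D\<in>Pow A. r ^ card D) = 1 + (\<Sum>D\<in>Pow A - {{}}. r ^ card D)"
    using assms by (subst sum.remove[of _ "{}"]) auto
  ultimately show ?thesis by simp
qed

section \<open>Least-squares loss and column spans\<close>

lemma transpose_mult_nth: "(transpose X *v v) $ j = column j X \<bullet> v"
  for X :: "real^'p^'n"
  by (simp add: matrix_vector_mult_def transpose_def column_def inner_vec_def)

lemma inner_matrix_mult_sum: "v \<bullet> (X *v b) = (\<Sum>j\<in>UNIV. b $ j * (column j X \<bullet> v))"
  for X :: "real^'p^'n"
  by (simp add: matrix_mult_sum inner_sum_right scalar_mult_eq_scaleR inner_commute)

lemma span_columns_eq: "span ((\<lambda>j. column j X) ` J) = (\<lambda>b. X *v b) ` {b. supp_vec b \<subseteq> J}"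
  for X :: "real^'p^'n"
proof
  have "subspace {b :: real^'p. supp_vec b \<subseteq> J}"
    by (auto simp: subspace_def supp_vec_def subset_iff) (metis add_0_right)
  then have "subspace ((\<lambda>b. X *v b) ` {b. supp_vec b \<subseteq> J})"
    by (rule linear_subspace_image[OF matrix_vector_mul_linear])
  moreover have "column j X \<in> (\<lambda>b. X *v b) ` {b. supp_vec b \<subseteq> J}" if "j \<in> J" for j
  proof
    show "column j X = X *v axis j 1" by (simp add: matrix_vector_mult_basis)
    show "axis j 1 \<in> {b :: real^'p. supp_vec b \<subseteq> J}"
      using that by (auto simp: supp_vec_def axis_def split: if_splits)
  qed
  ultimately show "span ((\<lambda>j. column j X) ` J) \<subseteq> (\<lambda>b. X *v b) ` {b. supp_vec b \<subseteq> J}"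
    by (intro span_minimal) auto
next
  show "(\<lambda>b. X *v b) ` {b. supp_vec b \<subseteq> J} \<subseteq> span ((\<lambda>j. column j X) ` J)"
  proof clarify
    fix b :: "real^'p" assume b: "supp_vec b \<subseteq> J"
    have "b $ j *\<^sub>R column j X \<in> span ((\<lambda>j. column j X) ` J)" for j
    proof (cases "j \<in> J")
      case True
      then show ?thesis by (intro span_scale span_base) auto
    next
      case False
      then have "b $ j = 0" using b by (auto simp: supp_vec_def)
      then show ?thesis by (simp add: span_zero)
    qed
    then show "X *v b \<in> span ((\<lambda>j. column j X) ` J)"
      by (auto simp: matrix_mult_sum scalar_mult_eq_scaleR intro!: span_sum)
  qed
qed

lemma loss_eq_residual: "loss X y b = (norm (y - X *v b))\<^sup>2 / 2 - (norm y)\<^sup>2 / 2"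
  for X :: "real^'p^'n"
proof -
  have "b \<bullet> (transpose X *v y) = (\<Sum>j\<in>UNIV. b $ j * (transpose X *v y) $ j)"
    by (simp only: inner_vec_def inner_real_def)
  also have "\<dots> = y \<bullet> (X *v b)"
    unfolding transpose_mult_nth by (rule inner_matrix_mult_sum[symmetric])
  finally have "b \<bullet> (transpose X *v y) = y \<bullet> (X *v b)" .
  then show ?thesis
    by (simp add: loss_def power2_norm_eq_inner inner_diff_left inner_diff_right inner_commute
      diff_divide_distrib add_divide_distrib)
qed

text \<open>Minimal losses are half squared distances from \<open>y\<close> to column spans, up to the common constant
\<open>- (norm y)\<^sup>2 / 2\<close>; this rule compares two of them without computing either.\<close>

lemma min_loss_le_add:
  fixes X :: "real^'p^'n"
  assumes "\<And>v. v \<in> span ((\<lambda>j. column j X) ` J) \<Longrightarrow>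
    \<exists>v'\<in>span ((\<lambda>j. column j X) ` K). (norm (y - v'))\<^sup>2 \<le> (norm (y - v))\<^sup>2 + 2 * c"
  shows "min_loss X y K \<le> min_loss X y J + c"
proof -
  have bdd: "bdd_below (loss X y ` A)" for A
    by (rule bdd_belowI[of _ "- (norm y)\<^sup>2 / 2"]) (auto simp: loss_eq_residual)
  have "min_loss X y K - c \<le> min_loss X y J"
    unfolding min_loss_def[of X y J]
  proof (rule cINF_greatest)
    show "{b :: real^'p. supp_vec b \<subseteq> J} \<noteq> {}"
      by (auto simp: supp_vec_def intro!: exI[of _ 0])
    fix b :: "real^'p" assume "b \<in> {b. supp_vec b \<subseteq> J}"
    then have "X *v b \<in> span ((\<lambda>j. column j X) ` J)" by (auto simp: span_columns_eq)
    from assms[OF this] obtain b' where b': "supp_vec b' \<subseteq> K"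
      "(norm (y - X *v b'))\<^sup>2 \<le> (norm (y - X *v b))\<^sup>2 + 2 * c"
      by (auto simp: span_columns_eq)
    have "min_loss X y K \<le> loss X y b'"
      unfolding min_loss_def using b' by (intro cINF_lower bdd) auto
    also have "\<dots> \<le> loss X y b + c" using b'(2) by (simp add: loss_eq_residual)
    finally show "min_loss X y K - c \<le> loss X y b" by simp
  qed
  then show ?thesis by simp
qed

text \<open>From any fit \<open>v\<close> in the smaller span one may move by \<open>z\<close>, which stays in the larger span; the
change of the squared residual does not depend on \<open>v\<close> because \<open>z\<close> is orthogonal to it.\<close>

lemma min_loss_gain_direction:
  fixes X :: "real^'p^'n"
  assumes "J \<subseteq> K" and z: "z \<in> span ((\<lambda>j. column j X) ` K)"
    and orth: "\<And>w. w \<in> span ((\<lambda>j. column j X) ` J) \<Longrightarrow> orthogonal z w"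
  shows "min_loss X y K \<le> min_loss X y J + ((norm z)\<^sup>2 / 2 - z \<bullet> y)"
proof (rule min_loss_le_add)
  fix v assume v: "v \<in> span ((\<lambda>j. column j X) ` J)"
  then have "v \<in> span ((\<lambda>j. column j X) ` K)"
    using span_mono[of "(\<lambda>j. column j X) ` J" "(\<lambda>j. column j X) ` K"] \<open>J \<subseteq> K\<close> by blast
  with z have "v + z \<in> span ((\<lambda>j. column j X) ` K)" by (rule span_add[rotated])
  moreover have "z \<bullet> v = 0" using orth[OF v] by (simp add: orthogonal_def)
  then have "(norm (y - (v + z)))\<^sup>2 = (norm (y - v))\<^sup>2 + 2 * ((norm z)\<^sup>2 / 2 - z \<bullet> y)"
    unfolding power2_norm_eq_inner
    by (simp add: inner_diff_left inner_diff_right inner_add_left inner_add_right inner_commute)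
  ultimately show "\<exists>v'\<in>span ((\<lambda>j. column j X) ` K).
      (norm (y - v'))\<^sup>2 \<le> (norm (y - v))\<^sup>2 + 2 * ((norm z)\<^sup>2 / 2 - z \<bullet> y)"
    by (intro bexI[of _ "v + z"]) auto
qed

text \<open>The columns in \<open>D\<close> enlarge the span of the columns in \<open>J\<close> by at most \<open>card D\<close> orthonormal
directions \<open>B\<close>, namely an orthonormal basis of what is left of these columns after projecting out
the span.  Each direction \<open>q\<close> reduces the squared residual by at most \<open>(q \<bullet> y)\<^sup>2\<close>.\<close>

lemma min_loss_gain_bounded_by_new_directions:
  fixes X :: "real^'p^'n"
  obtains B where "finite B" "pairwise orthogonal B" "\<forall>q\<in>B. norm q = 1"
    "card B \<le> card D"
    "\<forall>q\<in>B. \<forall>w\<in>span ((\<lambda>j. column j X) ` J). orthogonal q w"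
    "\<forall>y. min_loss X y J \<le> min_loss X y (J \<union> D) + (\<Sum>q\<in>B. (q \<bullet> y)\<^sup>2) / 2"
proof -
  let ?S = "span ((\<lambda>j. column j X) ` J)"
  have "\<exists>u z. u \<in> ?S \<and> (\<forall>w\<in>?S. orthogonal z w) \<and> column j X = u + z" for j
    using orthogonal_subspace_decomp_exists[of "(\<lambda>j. column j X) ` J" "column j X"] by metis
  then obtain u z where u: "\<And>j. u j \<in> ?S" and z: "\<And>j w. w \<in> ?S \<Longrightarrow> orthogonal (z j) w"
    and col: "\<And>j. column j X = u j + z j" by metis
  obtain B where B: "pairwise orthogonal B" "\<And>q. q \<in> B \<Longrightarrow> norm q = 1"
    "independent B" "card B = dim (span (z ` D))" "span B = span (z ` D)"
    using orthonormal_basis_subspace[OF subspace_span, of "z ` D"] by metis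
  have finB: "finite B" using B(3) by (rule independent_imp_finite)
  have "card B \<le> card (z ` D)" using B(4) dim_le_card' [of "z ` D"] by simp
  also have "\<dots> \<le> card D" by (rule card_image_le) simp
  finally have cardB: "card B \<le> card D" .
  have orth: "orthogonal q w" if "q \<in> B" "w \<in> ?S" for q w
  proof -
    have "q \<in> span (z ` D)" using that B(5) span_base by metis
    then have "orthogonal w q"
      using z[OF that(2)] by (intro orthogonal_to_span[of q "z ` D"]) (auto simp: orthogonal_commute)
    then show ?thesis by (simp add: orthogonal_commute)
  qed
  have split: "\<exists>s\<in>?S. \<exists>c. v = s + (\<Sum>q\<in>B. c q *\<^sub>R q)"
    if "v \<in> span ((\<lambda>j. column j X) ` (J \<union> D))" for v
  proof -
    have "(\<lambda>j. column j X) ` (J \<union> D) \<subseteq> {s + t |s t. s \<in> ?S \<and> t \<in> span B}"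
    proof clarify
      fix j assume j: "j \<in> J \<union> D"
      show "\<exists>s t. column j X = s + t \<and> s \<in> ?S \<and> t \<in> span B"
      proof (cases "j \<in> J")
        case True
        then show ?thesis
          by (intro exI[of _ "column j X"] exI[of _ 0]) (auto intro: span_base span_zero)
      next
        case False
        with j show ?thesis unfolding B(5)
          by (intro exI[of _ "u j"] exI[of _ "z j"] conjI col u span_base) auto
      qed
    qed
    then have "span ((\<lambda>j. column j X) ` (J \<union> D)) \<subseteq> {s + t |s t. s \<in> ?S \<and> t \<in> span B}"
      by (rule span_minimal) (intro subspace_sums subspace_span)
    with that obtain s t where "s \<in> ?S" "t \<in> span B" "v = s + t" by blast
    moreover then obtain c where "t = (\<Sum>q\<in>B. c q *\<^sub>R q)"
      using span_finite[OF finB] by auto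
    ultimately show ?thesis by blast
  qed
  have "min_loss X y J \<le> min_loss X y (J \<union> D) + (\<Sum>q\<in>B. (q \<bullet> y)\<^sup>2) / 2" for y
  proof (rule min_loss_le_add)
    fix v assume "v \<in> span ((\<lambda>j. column j X) ` (J \<union> D))"
    then obtain s c where s: "s \<in> ?S" and v: "v = s + (\<Sum>q\<in>B. c q *\<^sub>R q)" (is "_ = _ + ?t")
      using split by blast
    have "s \<bullet> ?t = 0"
      using orth s by (auto simp: inner_sum_right orthogonal_def inner_commute intro!: sum.neutral)
    moreover have "y \<bullet> ?t = (\<Sum>q\<in>B. c q * (q \<bullet> y))"
      by (simp add: inner_sum_right inner_commute)
    moreover have "(norm ?t)\<^sup>2 = (\<Sum>q\<in>B. (c q)\<^sup>2)"
    proof -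
      have "(norm ?t)\<^sup>2 = (\<Sum>q\<in>B. (norm (c q *\<^sub>R q))\<^sup>2)"
        using B(1) by (intro norm_sum_Pythagorean[OF finB])
          (auto simp: pairwise_def orthogonal_def)
      then show ?thesis using B(2) by (simp add: power_mult_distrib)
    qed
    ultimately have "(norm (y - v))\<^sup>2 = (norm (y - s))\<^sup>2 - 2 * (\<Sum>q\<in>B. c q * (q \<bullet> y)) + (\<Sum>q\<in>B. (c q)\<^sup>2)"
      unfolding v power2_norm_eq_inner
      by (simp add: inner_diff_left inner_diff_right inner_add_left inner_add_right inner_commute)
    \<comment> \<open>Completing the square in each coordinate \<open>c q\<close>.\<close>
    moreover have "2 * (\<Sum>q\<in>B. c q * (q \<bullet> y)) \<le> (\<Sum>q\<in>B. (c q)\<^sup>2) + (\<Sum>q\<in>B. (q \<bullet> y)\<^sup>2)"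
      unfolding sum_distrib_left sum.distrib[symmetric]
      using sum_squares_bound by (intro sum_mono) (simp add: mult.assoc)
    ultimately show "\<exists>v'\<in>?S. (norm (y - v'))\<^sup>2 \<le> (norm (y - v))\<^sup>2 + 2 * ((\<Sum>q\<in>B. (q \<bullet> y)\<^sup>2) / 2)"
      using s by (intro bexI[of _ s]) auto
  qed
  with B(2) orth show ?thesis by (intro that[OF finB B(1) _ cardB]) blast+
qed

section \<open>Stationarity and error of the Lasso\<close>

text \<open>The Karush-Kuhn-Tucker conditions, obtained without subdifferentials: the objective is compared
with its values after moving the \<open>j\<close>-th coordinate by \<open>h\<close>.  For a column of unit norm
the loss changes by exactly \<open>h\<^sup>2 / 2 - h * r\<close>.\<close>

lemma lasso_stationarity:
  fixes X :: "real^'p^'n"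
  assumes lasso: "is_lasso X y lam b" and "lam > 0" and nrm: "norm (column j X) = 1"
  defines "r \<equiv> column j X \<bullet> (y - X *v b)"
  shows "\<bar>r\<bar> \<le> lam" "lam * \<bar>b $ j\<bar> \<le> b $ j * r"
proof -
  have pert: "h * r \<le> h\<^sup>2 / 2 + lam * (\<bar>b $ j + h\<bar> - \<bar>b $ j\<bar>)" for h
  proof -
    let ?b' = "b + h *\<^sub>R axis j 1"
    have "loss X y b + lam * l1norm b \<le> loss X y ?b' + lam * l1norm ?b'"
      using lasso by (auto simp: is_lasso_def is_arg_min_def not_less)
    moreover have "loss X y ?b' = loss X y b - h * r + h\<^sup>2 / 2"
    proof -
      have "X *v ?b' = X *v b + h *\<^sub>R column j X"
        by (simp add: matrix_vector_right_distrib matrix_vector_mult_scaleR matrix_vector_mult_basis)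
      then have "y - X *v ?b' = (y - X *v b) - h *\<^sub>R column j X" by simp
      then have "(norm (y - X *v ?b'))\<^sup>2 = (norm (y - X *v b))\<^sup>2 - 2 * h * r + h\<^sup>2"
        using nrm unfolding r_def power2_norm_eq_inner norm_eq_1
        by (simp only: inner_diff_left inner_diff_right inner_scaleR_left inner_scaleR_right)
          (simp add: inner_diff_left inner_diff_right inner_commute algebra_simps power2_eq_square)
      then show ?thesis unfolding loss_eq_residual by simp
    qed
    moreover have "l1norm ?b' = l1norm b + (\<bar>b $ j + h\<bar> - \<bar>b $ j\<bar>)"
    proof -
      have "l1norm ?b' - l1norm b = (\<Sum>i\<in>UNIV. if i = j then \<bar>b $ j + h\<bar> - \<bar>b $ j\<bar> else 0)"
        unfolding l1norm_def sum_subtractf[symmetric]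
        by (intro sum.cong) (auto simp: axis_def)
      then show ?thesis by simp
    qed
    ultimately show ?thesis by (simp add: algebra_simps)
  qed
  show "\<bar>r\<bar> \<le> lam"
  proof (rule ccontr)
    assume "\<not> \<bar>r\<bar> \<le> lam"
    then have gap: "\<bar>r\<bar> - lam > 0" by simp
    \<comment> \<open>Soft thresholding of \<open>r\<close>: the minimiser of \<open>h\<^sup>2 / 2 - h * r + lam * \<bar>h\<bar>\<close>.\<close>
    define h where "h = sgn r * (\<bar>r\<bar> - lam)"
    have "r \<noteq> 0" using gap \<open>lam > 0\<close> by auto
    then have h: "\<bar>h\<bar> = \<bar>r\<bar> - lam" "h * r = (\<bar>r\<bar> - lam) * \<bar>r\<bar>" "h\<^sup>2 = (\<bar>r\<bar> - lam)\<^sup>2"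
      using gap by (auto simp: h_def abs_mult sgn_if power2_eq_square)
    have "lam * (\<bar>b $ j + h\<bar> - \<bar>b $ j\<bar>) \<le> lam * (\<bar>r\<bar> - lam)"
      using \<open>lam > 0\<close> h(1) by (intro mult_left_mono) auto
    with pert[of h] have "(\<bar>r\<bar> - lam) * \<bar>r\<bar> \<le> (\<bar>r\<bar> - lam)\<^sup>2 / 2 + lam * (\<bar>r\<bar> - lam)"
      using h by linarith
    moreover have "(\<bar>r\<bar> - lam) * \<bar>r\<bar> = (\<bar>r\<bar> - lam)\<^sup>2 + lam * (\<bar>r\<bar> - lam)"
      by (simp add: power2_eq_square algebra_simps)
    ultimately have "(\<bar>r\<bar> - lam)\<^sup>2 \<le> 0" by linarith
    with gap show False by simp
  qed
  show "lam * \<bar>b $ j\<bar> \<le> b $ j * r"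
  proof (rule ccontr)
    define d where "d = lam * \<bar>b $ j\<bar> - b $ j * r"
    assume "\<not> lam * \<bar>b $ j\<bar> \<le> b $ j * r"
    then have d: "d > 0" by (simp add: d_def)
    then have b: "(b $ j)\<^sup>2 > 0" by (auto simp: d_def)
    \<comment> \<open>Shrinking the coordinate by the factor \<open>1 - s\<close> lowers the objective by
      \<open>s * d - s\<^sup>2 * (b $ j)\<^sup>2 / 2\<close>.\<close>
    define s where "s = min 1 (d / (b $ j)\<^sup>2)"
    have s: "s > 0" "s \<le> 1" "s * (b $ j)\<^sup>2 \<le> d" using d b by (auto simp: s_def min_def field_simps)
    have "b $ j + (- (s * b $ j)) = (1 - s) * b $ j" by (simp add: algebra_simps)
    then have "\<bar>b $ j + (- (s * b $ j))\<bar> = (1 - s) * \<bar>b $ j\<bar>" using s by (simp only: abs_mult)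
    then have "\<bar>b $ j + (- (s * b $ j))\<bar> - \<bar>b $ j\<bar> = - (s * \<bar>b $ j\<bar>)"
      by (simp add: algebra_simps)
    with pert[of "- (s * b $ j)"] have
      "- (s * b $ j) * r \<le> (- (s * b $ j))\<^sup>2 / 2 + lam * (- (s * \<bar>b $ j\<bar>))"
      by (simp only:)
    then have "s * d \<le> s * (s * (b $ j)\<^sup>2 / 2)"
      by (simp add: d_def algebra_simps power2_eq_square)
    with s have "d \<le> s * (b $ j)\<^sup>2 / 2" by simp
    with s d show False by linarith
  qed
qed

lemma lasso_error_small_correlations:
  fixes X :: "real^'p^'n"
  assumes "is_lasso X (X *v \<beta> + e) lam b" "lam > 0" "\<And>j. norm (column j X) = 1"
    and noise: "\<And>j. \<bar>column j X \<bullet> e\<bar> \<le> a * lam"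
  shows "infnorm (transpose X *v (X *v (b - \<beta>))) \<le> (1 + a) * lam"
proof -
  have "\<bar>column j X \<bullet> (X *v (b - \<beta>))\<bar> \<le> (1 + a) * lam" for j
  proof -
    have "column j X \<bullet> (X *v (b - \<beta>)) = column j X \<bullet> e - column j X \<bullet> (X *v \<beta> + e - X *v b)"
      by (simp add: matrix_vector_mult_diff_distrib inner_diff_right inner_add_right)
    with lasso_stationarity(1)[OF assms(1,2) assms(3)[of j]] noise[of j] show ?thesis
      by (simp add: algebra_simps)
  qed
  then show ?thesis
    unfolding infnorm_cart transpose_mult_nth by (intro cSup_least) auto
qed

text \<open>Off the support of \<open>\<beta>\<close> the error is the estimate itself, so there stationarity bounds
\<open>v $ j * (column j X \<bullet> (X *v v))\<close> by \<open>- (1 - a) * lam * \<bar>v $ j\<bar>\<close>, which gives the sign condition.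
On the support the bound is \<open>(1 + a) * lam * \<bar>v $ j\<bar>\<close>.  These terms sum to \<open>(norm (X *v v))\<^sup>2\<close>,
hence to a nonnegative number, which gives the \<open>l1norm\<close> condition.\<close>

lemma lasso_error_in_sign_cone:
  fixes X :: "real^'p^'n"
  assumes "is_lasso X (X *v \<beta> + e) lam b" "lam > 0" "\<And>j. norm (column j X) = 1"
    and noise: "\<And>j. \<bar>column j X \<bullet> e\<bar> \<le> a * lam" and "a < 1"
  shows "b - \<beta> \<in> sign_cone X (supp_vec \<beta>) a"
proof -
  define v where "v = b - \<beta>"
  define T where "T = supp_vec \<beta>"
  define r where "r j = column j X \<bullet> (X *v \<beta> + e - X *v b)" for j
  have r: "\<bar>r j\<bar> \<le> lam" "lam * \<bar>b $ j\<bar> \<le> b $ j * r j" for j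
    using lasso_stationarity[OF assms(1,2) assms(3)[of j]] by (auto simp: r_def)
  have corr: "column j X \<bullet> (X *v v) = column j X \<bullet> e - r j" for j
    by (simp add: v_def r_def matrix_vector_mult_diff_distrib inner_diff_right inner_add_right)
  have noise_term: "x * (column j X \<bullet> e) \<le> a * lam * \<bar>x\<bar>" for x j
  proof -
    have "x * (column j X \<bullet> e) \<le> \<bar>x\<bar> * \<bar>column j X \<bullet> e\<bar>"
      by (metis abs_ge_self abs_mult)
    also have "\<dots> \<le> \<bar>x\<bar> * (a * lam)" by (intro mult_left_mono noise) auto
    finally show ?thesis by (simp add: mult_ac)
  qed
  have off: "v $ j * (column j X \<bullet> (X *v v)) \<le> - ((1 - a) * lam * \<bar>v $ j\<bar>)" if "j \<in> - T" for j
  proof -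
    have "v $ j = b $ j" using that by (simp add: v_def T_def supp_vec_def)
    then show ?thesis using r(2)[of j] noise_term[of "b $ j" j]
      unfolding corr by (simp add: algebra_simps)
  qed
  have on: "v $ j * (column j X \<bullet> (X *v v)) \<le> (1 + a) * lam * \<bar>v $ j\<bar>" for j
  proof -
    have "- (v $ j * r j) \<le> \<bar>v $ j\<bar> * \<bar>r j\<bar>" by (metis abs_ge_minus_self abs_mult)
    also have "\<dots> \<le> \<bar>v $ j\<bar> * lam" by (intro mult_left_mono r) auto
    finally show ?thesis using noise_term[of "v $ j" j]
      unfolding corr by (simp add: algebra_simps)
  qed
  have "0 \<le> (X *v v) \<bullet> (X *v v)" by simp
  also have "\<dots> = (\<Sum>j\<in>UNIV. v $ j * (column j X \<bullet> (X *v v)))" by (rule inner_matrix_mult_sum)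
  also have "\<dots> \<le> (\<Sum>j\<in>UNIV. (1 + a) * lam * \<bar>restrict_vec T v $ j\<bar>
      - (1 - a) * lam * \<bar>restrict_vec (- T) v $ j\<bar>)"
    using on off by (intro sum_mono) (auto simp: restrict_vec_def)
  also have "\<dots> = lam * ((1 + a) * l1norm (restrict_vec T v) - (1 - a) * l1norm (restrict_vec (- T) v))"
    unfolding sum_subtractf sum_distrib_left[symmetric] l1norm_def by (simp add: algebra_simps)
  finally have "(1 - a) * l1norm (restrict_vec (- T) v) \<le> (1 + a) * l1norm (restrict_vec T v)"
    using \<open>lam > 0\<close> by (simp add: zero_le_mult_iff)
  then have "l1norm (restrict_vec (- T) v) \<le> (1 + a) / (1 - a) * l1norm (restrict_vec T v)"
    using \<open>a < 1\<close> by (simp add: field_simps)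
  moreover have "v $ j * (column j X \<bullet> (X *v v)) \<le> 0" if "j \<in> - T" for j
  proof -
    have "0 \<le> (1 - a) * lam * \<bar>v $ j\<bar>" using assms by simp
    with off[OF that] show ?thesis by linarith
  qed
  ultimately show ?thesis by (simp add: sign_cone_def v_def T_def)
qed

lemma zeta_le_ratio:
  assumes "v \<in> sign_cone X T a" "v \<noteq> 0"
  shows "0 \<le> zeta X T a" "zeta X T a * infnorm v \<le> infnorm (transpose X *v (X *v v))"
proof -
  have ne: "sign_cone X T a - {0} \<noteq> {}" using assms by auto
  have nonneg: "0 \<le> infnorm (transpose X *v (X *v u)) / infnorm u" for u
    by (intro divide_nonneg_nonneg infnorm_pos_le)
  show "0 \<le> zeta X T a" unfolding zeta_def by (intro cINF_greatest ne nonneg)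
  have "zeta X T a \<le> infnorm (transpose X *v (X *v v)) / infnorm v"
    unfolding zeta_def using assms nonneg by (intro cINF_lower bdd_belowI2[of _ 0]) auto
  then show "zeta X T a * infnorm v \<le> infnorm (transpose X *v (X *v v))"
    using assms by (simp add: pos_le_divide_eq infnorm_pos_lt)
qed

lemma beta_min_le: "j \<in> supp_vec b \<Longrightarrow> beta_min b \<le> \<bar>b $ j\<bar>"
  by (simp add: beta_min_def)

lemma beta_min_pos: "supp_vec b \<noteq> {} \<Longrightarrow> 0 < beta_min b"
  by (simp add: beta_min_def) (simp add: supp_vec_def)

text \<open>By the definition of \<open>zeta\<close>, small correlations of the fitted error with the columns force the
error itself to be small in the maximum norm, as it lies in the cone.\<close>

lemma lasso_error_lt_half_beta_min:
  fixes X :: "real^'p^'n"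
  assumes "is_lasso X (X *v \<beta> + e) lam b" "lam > 0" "\<And>j. norm (column j X) = 1"
    and noise: "\<And>j. \<bar>column j X \<bullet> e\<bar> \<le> a * lam" and "0 < a" "a < 1"
    and "supp_vec \<beta> \<noteq> {}"
    and signal: "lam\<^sup>2 * (4 * (1 + a)\<^sup>2) < (zeta X (supp_vec \<beta>) a)\<^sup>2 * (beta_min \<beta>)\<^sup>2"
  shows "infnorm (b - \<beta>) < beta_min \<beta> / 2"
proof (cases "b = \<beta>")
  case True
  then show ?thesis using beta_min_pos assms by (simp add: infnorm_0)
next
  case False
  let ?\<zeta> = "zeta X (supp_vec \<beta>) a"
  have cone: "b - \<beta> \<in> sign_cone X (supp_vec \<beta>) a" "b - \<beta> \<noteq> 0"
    using lasso_error_in_sign_cone[OF assms(1-4,6)] False by auto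
  note z = zeta_le_ratio[OF cone]
  have "(2 * ((1 + a) * lam))\<^sup>2 < (?\<zeta> * beta_min \<beta>)\<^sup>2"
    using signal by (simp only: power_mult_distrib) (simp add: mult_ac)
  then have "2 * ((1 + a) * lam) < ?\<zeta> * beta_min \<beta>"
    by (rule power_less_imp_less_base) (use z(1) beta_min_pos[OF assms(7)] in simp)
  moreover have "?\<zeta> * infnorm (b - \<beta>) \<le> (1 + a) * lam"
    using z(2) lasso_error_small_correlations[OF assms(1-4)] by linarith
  ultimately have "?\<zeta> * infnorm (b - \<beta>) < ?\<zeta> * beta_min \<beta> / 2" by linarith
  then have "?\<zeta> * infnorm (b - \<beta>) < ?\<zeta> * (beta_min \<beta> / 2)" by simp
  then show ?thesis using z(1) by (rule mult_left_less_imp_less)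
qed

section \<open>Screening\<close>

lemma separation_of_coordinates:
  assumes close: "infnorm (b - \<beta>) < beta_min \<beta> / 2"
  shows "i \<in> supp_vec \<beta> \<Longrightarrow> beta_min \<beta> / 2 < \<bar>b $ i\<bar>"
    and "i \<notin> supp_vec \<beta> \<Longrightarrow> \<bar>b $ i\<bar> < beta_min \<beta> / 2"
proof -
  have le: "\<bar>b $ i - \<beta> $ i\<bar> < beta_min \<beta> / 2" for i
    using component_le_infnorm_cart[of "b - \<beta>" i] close by simp
  show "beta_min \<beta> / 2 < \<bar>b $ i\<bar>" if "i \<in> supp_vec \<beta>"
    using le[of i] beta_min_le[OF that] by linarith
  show "\<bar>b $ i\<bar> < beta_min \<beta> / 2" if "i \<notin> supp_vec \<beta>"
    using le[of i] that by (simp add: supp_vec_def)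
qed

text \<open>A prefix that contains a coordinate outside \<open>T\<close> and misses one inside \<open>T\<close> would list a smaller
modulus before a larger one.\<close>

lemma prefix_comparable_with_top_set:
  assumes js: "decreasing_order b js" and "T \<subseteq> supp_vec b"
    and sep: "\<And>i j. i \<in> T \<Longrightarrow> j \<notin> T \<Longrightarrow> \<bar>b $ j\<bar> < \<bar>b $ i\<bar>"
  shows "set (take k js) \<subseteq> T \<or> T \<subseteq> set (take k js)"
proof (rule ccontr)
  assume "\<not> ?thesis"
  then obtain x i where x: "x \<in> set (take k js)" "x \<notin> T" and i: "i \<in> T" "i \<notin> set (take k js)"
    by blast
  have eq: "js = take k js @ drop k js" by simp
  have "i \<in> set js" using js i assms(2) by (auto simp: decreasing_order_def)
  with i eq have "i \<in> set (drop k js)" by (metis Un_iff set_append)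
  moreover have "sorted_wrt (\<lambda>i j. \<bar>b $ i\<bar> \<ge> \<bar>b $ j\<bar>) (take k js @ drop k js)"
    using js by (simp add: decreasing_order_def)
  ultimately have "\<bar>b $ i\<bar> \<le> \<bar>b $ x\<bar>" using x by (auto simp only: sorted_wrt_append)
  with sep[OF i(1) x(2)] show False by simp
qed

lemma top_set_in_nested_family:
  assumes js: "decreasing_order b js" and "T \<subseteq> supp_vec b" "T \<noteq> {}"
    and sep: "\<And>i j. i \<in> T \<Longrightarrow> j \<notin> T \<Longrightarrow> \<bar>b $ j\<bar> < \<bar>b $ i\<bar>"
  shows "T \<in> nested_family js"
proof -
  have T: "card T \<le> length js" "card T \<ge> 1"
    using js assms(2,3) card_mono[of "set js" T] distinct_card[of js]
    by (auto simp: decreasing_order_def Suc_le_eq card_gt_0_iff finite_subset)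
  have "card (set (take (card T) js)) = card T"
    using js T by (subst distinct_card) (auto simp: decreasing_order_def)
  then have "set (take (card T) js) = T"
    using prefix_comparable_with_top_set[OF js assms(2) sep, of "card T"]
    by (metis List.finite_set card_subset_eq finite)
  with T show ?thesis by (auto simp: nested_family_def)
qed

definition ss_criterion :: "real^'p^'n \<Rightarrow> real^'n \<Rightarrow> real \<Rightarrow> 'p set \<Rightarrow> real" where
  "ss_criterion X y lam J = min_loss X y J + lam\<^sup>2 / 2 * real (card J)"

text \<open>A purely deterministic statement: when the noise is weakly correlated with all columns and the
signal is strong, the true support is among the candidates and each candidate is comparable with
it, so that a wrong output beats (or ties with) the truth while either omitting or adding
coordinates, but not both.\<close>

lemma ss_output_comparable_and_not_worse:
  fixes X :: "real^'p^'n"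
  assumes out: "ss_output X (X *v \<beta> + e) lam S"
    and "lam > 0" "\<And>j. norm (column j X) = 1"
    and noise: "\<And>j. \<bar>column j X \<bullet> e\<bar> \<le> a * lam" and "0 < a" "a < 1"
    and "supp_vec \<beta> \<noteq> {}"
    and signal: "lam\<^sup>2 * (4 * (1 + a)\<^sup>2) < (zeta X (supp_vec \<beta>) a)\<^sup>2 * (beta_min \<beta>)\<^sup>2"
  shows "S \<noteq> {}" "S \<subseteq> supp_vec \<beta> \<or> supp_vec \<beta> \<subseteq> S"
    "ss_criterion X (X *v \<beta> + e) lam S
      \<le> ss_criterion X (X *v \<beta> + e) lam (supp_vec \<beta>)"
proof -
  let ?T = "supp_vec \<beta>"
  from out obtain b js where lasso: "is_lasso X (X *v \<beta> + e) lam b"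
    and js: "decreasing_order b js"
    and sel: "if b = 0 then S = {} else is_arg_min
       (\<lambda>J. ss_criterion X (X *v \<beta> + e) lam J) (\<lambda>J. J \<in> nested_family js) S"
    unfolding ss_output_def ss_criterion_def by blast
  note close = lasso_error_lt_half_beta_min[OF lasso assms(2-)]
  note big = separation_of_coordinates(1)[OF close]
  have sep: "\<bar>b $ j\<bar> < \<bar>b $ i\<bar>" if "i \<in> ?T" "j \<notin> ?T" for i j
    using separation_of_coordinates(2)[OF close that(2)] big[OF that(1)] by linarith
  have sub: "?T \<subseteq> supp_vec b"
  proof
    fix i assume "i \<in> ?T"
    with big[of i] beta_min_pos[OF assms(7)] show "i \<in> supp_vec b" by (auto simp: supp_vec_def)
  qed
  have "b \<noteq> 0" using sub assms(7) by (auto simp: supp_vec_def)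
  with sel have S: "S \<in> nested_family js" and best: "\<And>J. J \<in> nested_family js \<Longrightarrow>
      ss_criterion X (X *v \<beta> + e) lam S
      \<le> ss_criterion X (X *v \<beta> + e) lam J"
    by (auto simp: is_arg_min_def not_less)
  show "S \<noteq> {}" using S by (auto simp: nested_family_def)
  show "S \<subseteq> ?T \<or> ?T \<subseteq> S"
    using S prefix_comparable_with_top_set[OF js sub sep] by (auto simp: nested_family_def)
  show "ss_criterion X (X *v \<beta> + e) lam S
      \<le> ss_criterion X (X *v \<beta> + e) lam ?T"
    by (rule best) (rule top_set_in_nested_family[OF js sub assms(7) sep])
qed

section \<open>Wrong selection forces large noise\<close>

lemma proj_cols_orthogonal:
  fixes X :: "real^'p^'n"
  shows "proj_cols X J v \<in> span ((\<lambda>j. column j X) ` J)"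
    and "w \<in> span ((\<lambda>j. column j X) ` J) \<Longrightarrow> orthogonal (v - proj_cols X J v) w"
  using theI'[OF proj_cols_unique[of X J v]] by (auto simp: proj_cols_def)

lemma restrict_vec_supp: "restrict_vec (supp_vec b) b = b"
  by (simp add: restrict_vec_def supp_vec_def vec_eq_iff)

lemma mean_in_span: "X *v b \<in> span ((\<lambda>j. column j X) ` supp_vec b)"
  for X :: "real^'p^'n"
  by (auto simp: span_columns_eq)

lemma delta_lt_projection_residual:
  fixes X :: "real^'p^'n"
  assumes "ereal c < delta X \<beta>" "D \<subset> supp_vec \<beta>" "D \<noteq> {}"
  defines "J \<equiv> supp_vec \<beta> - D"
  shows "c * real (card D) < (norm (X *v \<beta> - proj_cols X J (X *v \<beta>)))\<^sup>2"
proof -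
  let ?f = "\<lambda>J. (norm (X *v \<beta> - proj_cols X J (X *v \<beta>)))\<^sup>2"
  have D: "finite D" "card D < card (supp_vec \<beta>)" "card D \<ge> 1"
    using assms(2,3) by (auto simp: psubset_card_mono Suc_le_eq card_gt_0_iff)
  have "ereal c < ereal (delta_k X \<beta> (card D) / real (card D))"
    by (rule less_INF_D[OF assms(1)[unfolded delta_def]]) (use D in simp)
  then have "c * real (card D) < delta_k X \<beta> (card D)"
    using D by (simp add: field_simps)
  also have "\<dots> \<le> ?f J"
  proof -
    have "J \<subset> supp_vec \<beta> \<and> card (supp_vec \<beta> - J) = card D"
      using assms(2,3) unfolding J_def by (auto simp: double_diff)
    then show ?thesis unfolding delta_k_def Let_def restrict_vec_supp
      by (intro Min_le) auto
  qed
  finally show ?thesis .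
qed

text \<open>Let \<open>z\<close> be the part of the mean \<open>X *v \<beta>\<close> that the columns outside \<open>D\<close> cannot explain.  Adding \<open>z\<close>
to any fit without \<open>D\<close> changes half the squared residual by \<open>- (norm z)\<^sup>2 / 2 - z \<bullet> e\<close>, so \<open>D\<close> can be
dropped only if \<open>- (z \<bullet> e)\<close> is at least \<open>((norm z)\<^sup>2 - lam\<^sup>2 * card D) / 2\<close>.  As \<open>norm z\<close> exceeds
\<open>2 * (1 + a) * lam * sqrt (card D)\<close>, this is a large deviation of one linear form of the noise.\<close>

lemma underfit_forces_large_linear_noise:
  fixes X :: "real^'p^'n"
  assumes strong: "ereal (lam\<^sup>2 * (4 * (1 + a)\<^sup>2)) < delta X \<beta>" and "0 < a" "a < 1" "lam > 0"
    and D: "D \<subset> supp_vec \<beta>" "D \<noteq> {}"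
  obtains u where "u \<noteq> 0" "\<forall>e. ss_criterion X (X *v \<beta> + e) lam (supp_vec \<beta> - D)
      \<le> ss_criterion X (X *v \<beta> + e) lam (supp_vec \<beta>)
    \<longrightarrow> norm u * (a * lam * sqrt (real (card D))) \<le> u \<bullet> e"
proof -
  let ?T = "supp_vec \<beta>"
  let ?J = "?T - D"
  define m where "m = X *v \<beta>"
  define z where "z = m - proj_cols X ?J m"
  define k where "k = real (card D)"
  have k: "k > 0" using D by (simp add: k_def card_gt_0_iff)
  have card: "real (card ?T) = real (card ?J) + k"
    using D by (simp add: k_def card_Diff_subset card_mono psubset_imp_subset of_nat_diff)
  have big: "lam\<^sup>2 * (4 * (1 + a)\<^sup>2) * k < (norm z)\<^sup>2"
    using delta_lt_projection_residual[OF strong D] by (simp add: z_def m_def k_def)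
  have lk: "0 < lam\<^sup>2 * k" using k \<open>lam > 0\<close> by simp
  have "lam\<^sup>2 * (4 * (1 + a)\<^sup>2) * k = 4 * (lam\<^sup>2 * k) * (1 + a)\<^sup>2" by simp
  moreover have "(1 + a)\<^sup>2 \<ge> 1" using \<open>0 < a\<close> by (simp add: power2_eq_square algebra_simps)
  ultimately have z4: "4 * (lam\<^sup>2 * k) < (norm z)\<^sup>2"
    using big lk mult_left_mono[of 1 "(1 + a)\<^sup>2" "4 * (lam\<^sup>2 * k)"] by linarith
  with lk have "(norm z)\<^sup>2 > 0" by linarith
  then have z0: "- z \<noteq> 0" by auto
  have zJ: "orthogonal z w" if "w \<in> span ((\<lambda>j. column j X) ` ?J)" for w
    unfolding z_def by (rule proj_cols_orthogonal(2)[OF that])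
  have "proj_cols X ?J m \<in> span ((\<lambda>j. column j X) ` ?T)"
    by (rule subsetD[OF span_mono proj_cols_orthogonal(1)]) auto
  then have zT: "z \<in> span ((\<lambda>j. column j X) ` ?T)"
    unfolding z_def m_def by (intro span_diff mean_in_span)
  have zm: "z \<bullet> m = (norm z)\<^sup>2"
    using zJ[OF proj_cols_orthogonal(1)[of X ?J m]]
    by (simp add: power2_norm_eq_inner orthogonal_def) (simp add: z_def inner_diff_right)
  \<comment> \<open>\<open>3 / 8 = (1 - 1 / 4) / 2\<close> is the fraction of \<open>(norm z)\<^sup>2\<close> that remains in \<open>((norm z)\<^sup>2 - lam\<^sup>2 * k) / 2\<close>
    at least, as \<open>4 * (lam\<^sup>2 * k) < (norm z)\<^sup>2\<close>.\<close>
  have "2 * (1 + a) * (lam * sqrt k) < norm z"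
  proof (rule power_less_imp_less_base)
    show "(2 * (1 + a) * (lam * sqrt k))\<^sup>2 < (norm z)\<^sup>2"
      using big k by (simp only: power_mult_distrib) (simp add: mult_ac)
  qed simp
  moreover have "a * (lam * sqrt k) \<le> 3 / 8 * (2 * (1 + a)) * (lam * sqrt k)"
    using k \<open>lam > 0\<close> \<open>a < 1\<close> by (intro mult_right_mono) auto
  ultimately have "a * lam * sqrt k \<le> 3 / 8 * norm z" by (simp only: mult.assoc)
  then have zk: "norm z * (a * lam * sqrt k) \<le> norm z * (3 / 8 * norm z)"
    by (rule mult_left_mono) simp
  have "norm (- z) * (a * lam * sqrt (real (card D))) \<le> (- z) \<bullet> e"
    if "ss_criterion X (X *v \<beta> + e) lam ?J \<le> ss_criterion X (X *v \<beta> + e) lam ?T" for e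
  proof -
    have "min_loss X (m + e) ?T \<le> min_loss X (m + e) ?J + ((norm z)\<^sup>2 / 2 - z \<bullet> (m + e))"
      by (rule min_loss_gain_direction[OF _ zT zJ]) auto
    moreover have "min_loss X (m + e) ?J \<le> min_loss X (m + e) ?T + lam\<^sup>2 * k / 2"
      using that unfolding ss_criterion_def card m_def[symmetric] by (simp add: distrib_left)
    moreover have "z \<bullet> (m + e) = (norm z)\<^sup>2 - (- z) \<bullet> e" by (simp add: zm inner_add_right)
    ultimately have "3 / 8 * (norm z)\<^sup>2 \<le> (- z) \<bullet> e" using z4 by linarith
    with zk show ?thesis by (simp add: k_def power2_eq_square mult_ac)
  qed
  with z0 show ?thesis by (intro that[of "- z"]) blast+
qed

lemma (in prob_space) underfit_probability:
  fixes X :: "real^'p^'n" and \<epsilon> :: "'a \<Rightarrow> real^'n"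
  assumes sg: "subgaussian_vector M \<sigma> \<epsilon>" and "\<sigma> > 0"
    and strong: "ereal (lam\<^sup>2 * (4 * (1 + a)\<^sup>2)) < delta X \<beta>" and a: "0 < a" "a < 1" and "lam > 0"
    and D: "D \<subset> supp_vec \<beta>" "D \<noteq> {}"
  obtains E where "E \<in> events"
    "{w \<in> space M. ss_criterion X (X *v \<beta> + \<epsilon> w) lam (supp_vec \<beta> - D)
      \<le> ss_criterion X (X *v \<beta> + \<epsilon> w) lam (supp_vec \<beta>)} \<subseteq> E"
    "prob E \<le> exp (- a\<^sup>2 * (lam\<^sup>2 / \<sigma>\<^sup>2) / 2) ^ card D"
proof -
  have [measurable]: "\<epsilon> \<in> borel_measurable M" using sg by (simp add: subgaussian_vector_def)
  obtain u where u: "u \<noteq> 0" "\<forall>e. ss_criterion X (X *v \<beta> + e) lam (supp_vec \<beta> - D)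
      \<le> ss_criterion X (X *v \<beta> + e) lam (supp_vec \<beta>)
    \<longrightarrow> norm u * (a * lam * sqrt (real (card D))) \<le> u \<bullet> e"
    by (rule underfit_forces_large_linear_noise[OF strong a \<open>lam > 0\<close> D])
  let ?s = "a * lam * sqrt (real (card D))"
  let ?E = "{w \<in> space M. norm u * ?s \<le> u \<bullet> \<epsilon> w}"
  have "?s > 0" using a \<open>lam > 0\<close> D by (simp add: card_gt_0_iff)
  from subgaussian_vector_linear_tail[OF sg \<open>\<sigma> > 0\<close> this u(1)]
  have "prob ?E \<le> exp (- ?s\<^sup>2 / (2 * \<sigma>\<^sup>2))" by (simp add: emeasure_eq_measure)
  also have "- ?s\<^sup>2 / (2 * \<sigma>\<^sup>2) = real (card D) * (- a\<^sup>2 * (lam\<^sup>2 / \<sigma>\<^sup>2) / 2)"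
    by (simp add: power_mult_distrib mult_ac)
  also have "exp \<dots> = exp (- a\<^sup>2 * (lam\<^sup>2 / \<sigma>\<^sup>2) / 2) ^ card D" by (rule exp_of_nat_mult)
  finally have "prob ?E \<le> exp (- a\<^sup>2 * (lam\<^sup>2 / \<sigma>\<^sup>2) / 2) ^ card D" .
  with u(2) show ?thesis by (intro that[of ?E]) auto
qed

text \<open>Beyond the span of the true columns the mean has no component, so the gain from the extra columns
\<open>D\<close> comes from the noise alone: it is at most half its squared length in at most \<open>card D\<close>
orthonormal directions, and it has to pay the penalty \<open>lam\<^sup>2 / 2 * card D\<close>.\<close>

lemma (in prob_space) overfit_probability:
  fixes X :: "real^'p^'n" and \<epsilon> :: "'a \<Rightarrow> real^'n"
  assumes sg: "subgaussian_vector M \<sigma> \<epsilon>" and "\<sigma> > 0"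
    and \<tau>: "lam\<^sup>2 / \<sigma>\<^sup>2 > 1" and D: "D \<inter> supp_vec \<beta> = {}"
  obtains E where "E \<in> events"
    "{w \<in> space M. ss_criterion X (X *v \<beta> + \<epsilon> w) lam (supp_vec \<beta> \<union> D)
      \<le> ss_criterion X (X *v \<beta> + \<epsilon> w) lam (supp_vec \<beta>)} \<subseteq> E"
    "prob E \<le> exp (- (lam\<^sup>2 / \<sigma>\<^sup>2 - 1 - ln (lam\<^sup>2 / \<sigma>\<^sup>2)) / 2) ^ card D"
proof -
  have [measurable]: "\<epsilon> \<in> borel_measurable M" using sg by (simp add: subgaussian_vector_def)
  let ?T = "supp_vec \<beta>"
  obtain B where B: "finite B" "pairwise orthogonal B" "\<forall>q\<in>B. norm q = 1"
    "card B \<le> card D" and orth: "\<forall>q\<in>B. \<forall>w\<in>span ((\<lambda>j. column j X) ` ?T). orthogonal q w"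
    and gain: "\<forall>y. min_loss X y ?T \<le> min_loss X y (?T \<union> D) + (\<Sum>q\<in>B. (q \<bullet> y)\<^sup>2) / 2"
    by (rule min_loss_gain_bounded_by_new_directions[where X=X and J="?T" and D=D])
  have noise: "q \<bullet> (X *v \<beta> + e) = q \<bullet> e" if "q \<in> B" for q e
    using orth that mean_in_span[of X \<beta>] by (simp add: inner_add_right orthogonal_def)
  let ?E = "{w \<in> space M. real (card D) * (\<sigma>\<^sup>2 * (lam\<^sup>2 / \<sigma>\<^sup>2)) \<le> (\<Sum>q\<in>B. (q \<bullet> \<epsilon> w)\<^sup>2)}"
  have "prob ?E \<le> exp (- (lam\<^sup>2 / \<sigma>\<^sup>2 - 1 - ln (lam\<^sup>2 / \<sigma>\<^sup>2)) / 2) ^ card D"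
    using subgaussian_vector_squares_tail[OF sg \<open>\<sigma> > 0\<close> \<tau> B(1,2) _ B(4)] B(3)
    by (simp add: emeasure_eq_measure)
  moreover have "real (card D) * (\<sigma>\<^sup>2 * (lam\<^sup>2 / \<sigma>\<^sup>2)) \<le> (\<Sum>q\<in>B. (q \<bullet> e)\<^sup>2)"
    if "ss_criterion X (X *v \<beta> + e) lam (?T \<union> D)
      \<le> ss_criterion X (X *v \<beta> + e) lam ?T" for e
  proof -
    have "card (?T \<union> D) = card ?T + card D" using D by (intro card_Un_disjoint) auto
    moreover have "(\<Sum>q\<in>B. (q \<bullet> (X *v \<beta> + e))\<^sup>2) = (\<Sum>q\<in>B. (q \<bullet> e)\<^sup>2)"
      by (intro sum.cong) (auto simp: noise)
    ultimately show ?thesis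
      using that gain[rule_format, of "X *v \<beta> + e"] \<open>\<sigma> > 0\<close>
      by (simp add: ss_criterion_def distrib_left mult.commute add_divide_distrib)
  qed
  ultimately show ?thesis by (intro that[of ?E]) auto
qed

section \<open>Union bounds and tuning\<close>

lemma (in prob_space) prob_column_noise_exceeds_le:
  fixes X :: "real^'p^'n" and \<epsilon> :: "'a \<Rightarrow> real^'n"
  assumes sg: "subgaussian_vector M \<sigma> \<epsilon>" and "\<sigma> > 0" "0 < s" and nrm: "\<And>j. norm (column j X) = 1"
  shows "prob {w \<in> space M. \<exists>j. s < \<bar>column j X \<bullet> \<epsilon> w\<bar>}
    \<le> 2 * (real CARD('p) * exp (- s\<^sup>2 / (2 * \<sigma>\<^sup>2)))"
proof -
  have [measurable]: "\<epsilon> \<in> borel_measurable M" using sg by (simp add: subgaussian_vector_def)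
  define A where "A c j = {w \<in> space M. norm (c *\<^sub>R column j X) * s \<le> (c *\<^sub>R column j X) \<bullet> \<epsilon> w}"
    for c :: real and j
  have [measurable]: "A c j \<in> events" for c j unfolding A_def by measurable
  have le: "prob (A c j) \<le> exp (- s\<^sup>2 / (2 * \<sigma>\<^sup>2))" if "c \<noteq> 0" for c j
  proof -
    have "c *\<^sub>R column j X \<noteq> 0" using nrm[of j] that by auto
    from subgaussian_vector_linear_tail[OF sg assms(2,3) this] show ?thesis
      by (simp add: emeasure_eq_measure A_def)
  qed
  have "{w \<in> space M. \<exists>j. s < \<bar>column j X \<bullet> \<epsilon> w\<bar>} \<subseteq> (\<Union>j\<in>UNIV. A 1 j) \<union> (\<Union>j\<in>UNIV. A (-1) j)"
    by (auto simp: A_def nrm abs_if split: if_splits) (metis less_imp_le minus_less_iff)+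
  then have "prob {w \<in> space M. \<exists>j. s < \<bar>column j X \<bullet> \<epsilon> w\<bar>}
      \<le> prob ((\<Union>j\<in>UNIV. A 1 j) \<union> (\<Union>j\<in>UNIV. A (-1) j))"
    by (intro finite_measure_mono) auto
  also have "\<dots> \<le> prob (\<Union>j\<in>UNIV. A 1 j) + prob (\<Union>j\<in>UNIV. A (-1) j)"
    by (intro measure_Un_le) auto
  also have "\<dots> \<le> (\<Sum>j\<in>UNIV. prob (A 1 j)) + (\<Sum>j\<in>UNIV. prob (A (-1) j))"
    by (intro add_mono measure_UNION_le) auto
  also have "\<dots> \<le> (\<Sum>j\<in>(UNIV :: 'p set). exp (- s\<^sup>2 / (2 * \<sigma>\<^sup>2)))
      + (\<Sum>j\<in>(UNIV :: 'p set). exp (- s\<^sup>2 / (2 * \<sigma>\<^sup>2)))"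
    by (intro add_mono sum_mono le) auto
  finally show ?thesis by simp
qed

lemma (in finite_measure) measure_family_le_exp:
  assumes "finite A" "\<And>D. D \<in> Pow A - {{}} \<Longrightarrow> E D \<in> sets M \<and> measure M (E D) \<le> r ^ card D"
    and "0 \<le> r" "real (card A) * r \<le> q"
  shows "measure M (\<Union>D\<in>Pow A - {{}}. E D) \<le> exp q - 1"
proof -
  have "measure M (\<Union>D\<in>Pow A - {{}}. E D) \<le> (\<Sum>D\<in>Pow A - {{}}. measure M (E D))"
    using assms by (intro measure_UNION_le) auto
  also have "\<dots> \<le> (\<Sum>D\<in>Pow A - {{}}. r ^ card D)" using assms by (intro sum_mono) auto
  also have "\<dots> \<le> exp (real (card A) * r) - 1" using assms by (intro sum_nonempty_subsets_power_le)
  also have "\<dots> \<le> exp q - 1" using assms by simp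
  finally show ?thesis .
qed

text \<open>The bounds on \<open>a\<close> and \<open>lam\<close> are what makes the number \<open>p\<close> of columns negligible.  The lower bound
on \<open>lam\<close> says \<open>p \<le> exp (a ^ 4 * \<tau> / 2)\<close>, which costs \<open>a ^ 4\<close> of the exponent \<open>a\<^sup>2\<close> of a linear tail.
The upper bound on \<open>a\<close> says \<open>(1 + ln L) / L \<le> 1 - a\<^sup>2\<close> for \<open>L = 2 * ln p \<le> \<tau>\<close>, and hence
\<open>\<tau> - 1 - ln \<tau> \<ge> a\<^sup>2 * \<tau>\<close>: the chi-square tail is as good as the linear one.\<close>

lemma tuning_parameter_consequences:
  fixes p a lam \<sigma> :: real
  assumes "2 \<le> p" "\<sigma> > 0" "0 < a"
    and a: "a \<le> sqrt (1 - (1 + ln (2 * ln p)) / (2 * ln p))"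
    and lam: "2 * \<sigma>\<^sup>2 * ln p / a ^ 4 \<le> lam\<^sup>2"
  defines "\<tau> \<equiv> lam\<^sup>2 / \<sigma>\<^sup>2"
  shows "a < 1" "1 < \<tau>"
    "p * exp (- a\<^sup>2 * \<tau> / 2) \<le> exp (- (a\<^sup>2 * (1 - a\<^sup>2) * \<tau> / 2))"
    "p * exp (- (\<tau> - 1 - ln \<tau>) / 2) \<le> exp (- (a\<^sup>2 * (1 - a\<^sup>2) * \<tau> / 2))"
proof -
  define L where "L = 2 * ln p"
  have "ln 2 \<le> ln p" using \<open>2 \<le> p\<close> by simp
  then have L: "L > 1" using ln2_ge_two_thirds by (simp add: L_def)
  have a': "a \<le> sqrt (1 - (1 + ln L) / L)" using a unfolding L_def .
  with \<open>0 < a\<close> have "0 < sqrt (1 - (1 + ln L) / L)" by linarith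
  then have pos: "0 \<le> 1 - (1 + ln L) / L" by simp
  have "a\<^sup>2 \<le> (sqrt (1 - (1 + ln L) / L))\<^sup>2"
    using a' \<open>0 < a\<close> by (intro power_mono) linarith+
  with pos have a2: "(1 + ln L) / L \<le> 1 - a\<^sup>2" by simp
  moreover have "0 < (1 + ln L) / L" using L by (intro divide_pos_pos) (auto simp: add_pos_nonneg)
  ultimately have "a\<^sup>2 < 1" by linarith
  then show "a < 1" using \<open>0 < a\<close> by (simp add: power_less_one_iff)
  have \<tau>: "L \<le> a ^ 4 * \<tau>"
    using lam assms(2,3) by (simp add: L_def \<tau>_def field_simps)
  have "\<tau> \<ge> 0" by (simp add: \<tau>_def)
  moreover have "a ^ 4 \<le> 1" using \<open>a < 1\<close> \<open>0 < a\<close> by (simp add: power_le_one)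
  ultimately have "a ^ 4 * \<tau> \<le> \<tau>" by (simp add: mult_left_le_one_le)
  with \<tau> have L\<tau>: "L \<le> \<tau>" by simp
  with L show "1 < \<tau>" by simp
  have p: "p = exp (L / 2)" using \<open>2 \<le> p\<close> by (simp add: L_def)
  have a4: "a\<^sup>2 * (1 - a\<^sup>2) * \<tau> = a\<^sup>2 * \<tau> - a ^ 4 * \<tau>"
    by (simp add: algebra_simps power4_eq_xxxx power2_eq_square)
  show "p * exp (- a\<^sup>2 * \<tau> / 2) \<le> exp (- (a\<^sup>2 * (1 - a\<^sup>2) * \<tau> / 2))"
    unfolding p exp_add[symmetric] a4 using \<tau> by (simp add: field_simps)
  \<comment> \<open>The function \<open>(1 + ln x) / x\<close> is decreasing for \<open>x \<ge> 1\<close>.\<close>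
  have "1 + ln \<tau> \<le> \<tau> * ((1 + ln L) / L)"
  proof -
    define x where "x = \<tau> / L"
    have x: "x \<ge> 1" "\<tau> = x * L" using L L\<tau> by (auto simp: x_def)
    have "ln \<tau> = ln x + ln L" using x L by (simp add: ln_mult)
    also have "ln x \<le> x - 1" using x by (intro ln_le_minus_one) auto
    also have "ln L \<le> x * ln L" using x L by simp
    finally have "1 + ln \<tau> \<le> x * (1 + ln L)" by (simp add: distrib_left)
    also have "\<dots> = \<tau> * ((1 + ln L) / L)" using x L by simp
    finally show ?thesis .
  qed
  also have "\<dots> \<le> \<tau> * (1 - a\<^sup>2)" using a2 \<open>\<tau> \<ge> 0\<close> by (rule mult_left_mono)
  finally have "1 + ln \<tau> \<le> \<tau> - a\<^sup>2 * \<tau>" by (simp add: algebra_simps)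
  then show "p * exp (- (\<tau> - 1 - ln \<tau>) / 2) \<le> exp (- (a\<^sup>2 * (1 - a\<^sup>2) * \<tau> / 2))"
    unfolding p exp_add[symmetric] a4 using \<tau> by (simp add: field_simps)
qed

theorem theorem3:
  fixes M :: "'w measure"
    and X :: "real^'p^'n"
    and \<beta> :: "real^'p"
    and \<epsilon> y :: "'w \<Rightarrow> real^'n"
    and T :: "'p set"
    and That :: "'w \<Rightarrow> 'p set"
    and \<sigma> lam a :: real
  assumes "prob_space M"
    and "\<And>j. norm (column j X) = 1"
    and "T = supp_vec \<beta>" and "T \<noteq> {}" and "card T < min CARD('n) CARD('p)"
    and "prob_space.indep_vars M (\<lambda>_. borel) (\<lambda>i w. \<epsilon> w $ i) UNIV"
    and "\<And>i. integrable M (\<lambda>w. \<epsilon> w $ i)"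
    and "\<And>i. (\<integral>w. \<epsilon> w $ i \<partial>M) = 0"
    and "\<sigma> > 0" and "\<And>i. subgaussian M \<sigma> (\<lambda>w. \<epsilon> w $ i)"
    and "\<And>w. w \<in> space M \<Longrightarrow> y w = X *v \<beta> + \<epsilon> w"
    and "lam > 0"
    and "\<And>w. w \<in> space M \<Longrightarrow> ss_output X (y w) lam (That w)"
    and "{w \<in> space M. That w \<noteq> T} \<in> sets M"
    and "0 < a"
    and "a \<le> sqrt (1 - (1 + ln (2 * ln (real CARD('p)))) / (2 * ln (real CARD('p))))"
    and "2 * \<sigma>\<^sup>2 * ln (real CARD('p)) / a ^ 4 \<le> lam\<^sup>2"
    and "ereal (lam\<^sup>2) <
           min (ereal ((zeta X T a)\<^sup>2 * (beta_min \<beta>)\<^sup>2)) (delta X \<beta>) / ereal (4 * (1 + a)\<^sup>2)"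
  shows "measure M {w \<in> space M. That w \<noteq> T} \<le>
           5 * exp (- (a\<^sup>2 * (1 - a\<^sup>2) * lam\<^sup>2 / (2 * \<sigma>\<^sup>2)))"
proof -
  interpret prob_space M by fact
  note nrm = assms(2) and \<sigma> = \<open>\<sigma> > 0\<close>
  have T: "supp_vec \<beta> = T" using assms(3) ..
  have sg: "subgaussian_vector M \<sigma> \<epsilon>"
    using assms by (intro subgaussian_vector_of_indep_coordinates) auto
  have "card T > 0" using \<open>T \<noteq> {}\<close> by (simp add: card_gt_0_iff)
  then have p: "2 \<le> real CARD('p)" using assms(5) by linarith
  define \<tau> where "\<tau> = lam\<^sup>2 / \<sigma>\<^sup>2"
  define q where "q = exp (- (a\<^sup>2 * (1 - a\<^sup>2) * \<tau> / 2))"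
  define r where "r = exp (- a\<^sup>2 * \<tau> / 2)"
  define r' where "r' = exp (- (\<tau> - 1 - ln \<tau>) / 2)"
  note tuning = tuning_parameter_consequences[OF p \<sigma> \<open>0 < a\<close> assms(16,17)]
  have "a < 1" by (rule tuning(1))
  have \<tau>: "\<tau> > 1" and pr: "real CARD('p) * r \<le> q" "real CARD('p) * r' \<le> q"
    using tuning(2-4) by (simp_all add: \<tau>_def r_def r'_def q_def)
  have c: "0 < 4 * (1 + a)\<^sup>2" using \<open>0 < a\<close> by simp
  have "ereal (lam\<^sup>2) * ereal (4 * (1 + a)\<^sup>2) <
      min (ereal ((zeta X T a)\<^sup>2 * (beta_min \<beta>)\<^sup>2)) (delta X \<beta>)"
    using assms(18) c by (subst (asm) ereal_less_divide_pos) (auto simp: mult.commute)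
  then have signal: "lam\<^sup>2 * (4 * (1 + a)\<^sup>2) < (zeta X T a)\<^sup>2 * (beta_min \<beta>)\<^sup>2"
    and strong: "ereal (lam\<^sup>2 * (4 * (1 + a)\<^sup>2)) < delta X \<beta>"
    by auto
  define worse where "worse S w \<longleftrightarrow> ss_criterion X (X *v \<beta> + \<epsilon> w) lam S
      \<le> ss_criterion X (X *v \<beta> + \<epsilon> w) lam T" for S w
  define N where "N = {w \<in> space M. \<exists>j. a * lam < \<bar>column j X \<bullet> \<epsilon> w\<bar>}"
  \<comment> \<open>Dropping all of \<open>T\<close> would give the empty set, which is never selected here.\<close>
  have "\<exists>E. E \<in> events \<and> prob E \<le> r ^ card D \<and>
      (D \<noteq> T \<longrightarrow> {w \<in> space M. worse (T - D) w} \<subseteq> E)" if "D \<in> Pow T - {{}}" for D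
  proof (cases "D = T")
    case True
    then show ?thesis by (intro exI[of _ "{}"]) (auto simp: r_def)
  next
    case False
    with that have "D \<subset> supp_vec \<beta>" "D \<noteq> {}" by (auto simp: T)
    then obtain E where "E \<in> events"
      "{w \<in> space M. ss_criterion X (X *v \<beta> + \<epsilon> w) lam (supp_vec \<beta> - D)
        \<le> ss_criterion X (X *v \<beta> + \<epsilon> w) lam (supp_vec \<beta>)} \<subseteq> E"
      "prob E \<le> exp (- a\<^sup>2 * (lam\<^sup>2 / \<sigma>\<^sup>2) / 2) ^ card D"
      by (rule underfit_probability[OF sg \<sigma> strong \<open>0 < a\<close> \<open>a < 1\<close> \<open>lam > 0\<close>])
    then show ?thesis unfolding T worse_def r_def \<tau>_def by (intro exI[of _ E] conjI impI)
  qed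
  then obtain U where U: "\<And>D. D \<in> Pow T - {{}} \<Longrightarrow> U D \<in> events \<and> prob (U D) \<le> r ^ card D \<and>
      (D \<noteq> T \<longrightarrow> {w \<in> space M. worse (T - D) w} \<subseteq> U D)" by metis
  have "\<exists>E. E \<in> events \<and> prob E \<le> r' ^ card D \<and>
      {w \<in> space M. worse (T \<union> D) w} \<subseteq> E" if "D \<in> Pow (- T) - {{}}" for D
  proof -
    have "D \<inter> supp_vec \<beta> = {}" using that by (auto simp: T)
    then obtain E where "E \<in> events"
      "{w \<in> space M. ss_criterion X (X *v \<beta> + \<epsilon> w) lam (supp_vec \<beta> \<union> D)
        \<le> ss_criterion X (X *v \<beta> + \<epsilon> w) lam (supp_vec \<beta>)} \<subseteq> E"
      "prob E \<le> exp (- (lam\<^sup>2 / \<sigma>\<^sup>2 - 1 - ln (lam\<^sup>2 / \<sigma>\<^sup>2)) / 2) ^ card D"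
      by (rule overfit_probability[OF sg \<sigma> \<tau>[unfolded \<tau>_def]])
    then show ?thesis unfolding T worse_def r'_def \<tau>_def by (intro exI[of _ E] conjI)
  qed
  then obtain V where V: "\<And>D. D \<in> Pow (- T) - {{}} \<Longrightarrow> V D \<in> events \<and> prob (V D) \<le> r' ^ card D \<and>
      {w \<in> space M. worse (T \<union> D) w} \<subseteq> V D" by metis
  let ?U = "\<Union>D\<in>Pow T - {{}}. U D" and ?V = "\<Union>D\<in>Pow (- T) - {{}}. V D"
  have [measurable]: "\<epsilon> \<in> borel_measurable M" using sg by (simp add: subgaussian_vector_def)
  have events: "N \<in> events" "?U \<in> events" "?V \<in> events"
    using U V unfolding N_def by (auto intro!: sets.finite_UN)
  have cover: "{w \<in> space M. That w \<noteq> T} \<subseteq> (N \<union> ?U) \<union> ?V"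
  proof (rule subsetI, rule ccontr)
    fix w assume "w \<in> {w \<in> space M. That w \<noteq> T}" "w \<notin> (N \<union> ?U) \<union> ?V"
    then have w: "w \<in> space M" "That w \<noteq> T" "w \<notin> ?V" "w \<notin> N" "w \<notin> ?U" by blast+
    define S where "S = That w"
    have out: "ss_output X (X *v \<beta> + \<epsilon> w) lam S" using assms(11,13) w(1) by (simp add: S_def)
    have noise: "\<bar>column j X \<bullet> \<epsilon> w\<bar> \<le> a * lam" for j using w by (auto simp: N_def not_less)
    note sel = ss_output_comparable_and_not_worse[OF out \<open>lam > 0\<close> nrm noise \<open>0 < a\<close> \<open>a < 1\<close>,
      unfolded T, OF \<open>T \<noteq> {}\<close> signal]
    have "worse S w" using sel(3) unfolding worse_def .
    from sel(2) show False
    proof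
      assume "S \<subseteq> T"
      then have "T - S \<in> Pow T - {{}}" "T - S \<noteq> T" "T - (T - S) = S"
        using sel(1) w(2) by (auto simp: S_def)
      with U[of "T - S"] \<open>worse S w\<close> w show False by auto
    next
      assume "T \<subseteq> S"
      then have "S - T \<in> Pow (- T) - {{}}" "T \<union> (S - T) = S"
        using w(2) by (auto simp: S_def)
      with V[of "S - T"] \<open>worse S w\<close> w show False by auto
    qed
  qed
  have q0: "q > 0" by (simp add: q_def)
  have probN: "prob N \<le> 2 * q"
  proof -
    have "prob N \<le> 2 * (real CARD('p) * exp (- (a * lam)\<^sup>2 / (2 * \<sigma>\<^sup>2)))"
      unfolding N_def using \<open>0 < a\<close> \<open>lam > 0\<close>
      by (intro prob_column_noise_exceeds_le[OF sg \<sigma> _ nrm]) simp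
    also have "- (a * lam)\<^sup>2 / (2 * \<sigma>\<^sup>2) = - a\<^sup>2 * \<tau> / 2" by (simp add: \<tau>_def power_mult_distrib)
    finally show ?thesis using pr(1) by (simp add: r_def)
  qed
  have probU: "prob ?U \<le> exp q - 1"
  proof (rule measure_family_le_exp)
    have "real (card T) * r \<le> real CARD('p) * r"
      by (intro mult_right_mono) (auto simp: r_def card_mono)
    then show "real (card T) * r \<le> q" using pr(1) by simp
  qed (use U in \<open>auto simp: r_def\<close>)
  have probV: "prob ?V \<le> exp q - 1"
  proof (rule measure_family_le_exp)
    have "real (card (- T)) * r' \<le> real CARD('p) * r'"
      by (intro mult_right_mono) (auto simp: r'_def card_mono)
    then show "real (card (- T)) * r' \<le> q" using pr(2) by simp
  qed (use V in \<open>auto simp: r'_def\<close>)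
  have "prob {w \<in> space M. That w \<noteq> T} \<le> prob ((N \<union> ?U) \<union> ?V)"
    using cover events by (intro finite_measure_mono) auto
  also have "\<dots> \<le> prob (N \<union> ?U) + prob ?V"
    using events by (intro measure_Un_le) auto
  also have "\<dots> \<le> (prob N + prob ?U) + prob ?V"
    using events by (intro add_right_mono measure_Un_le) auto
  also have "\<dots> \<le> (2 * q + (exp q - 1)) + (exp q - 1)"
    by (intro add_mono probN probU probV)
  finally have total: "prob {w \<in> space M. That w \<noteq> T} \<le> 2 * q + 2 * (exp q - 1)"
    by simp
  have "prob {w \<in> space M. That w \<noteq> T} \<le> 5 * q"
  \<comment> \<open>For \<open>q > 1 / 5\<close> the claimed bound exceeds \<open>1\<close>.\<close>
  proof (cases "q \<le> 1 / 5")
    case True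
    then have "q\<^sup>2 \<le> q / 5" using q0 by (simp add: power2_eq_square)
    moreover have "exp q \<le> 1 + q + q\<^sup>2" using q0 True by (intro exp_bound) auto
    ultimately have "2 * q + 2 * (exp q - 1) \<le> 5 * q" using q0 by (simp add: algebra_simps)
    with total show ?thesis by (rule order_trans)
  next
    case False
    then have "1 \<le> 5 * q" by linarith
    with prob_le_1 show ?thesis by (rule order_trans)
  qed
  also have "q = exp (- (a\<^sup>2 * (1 - a\<^sup>2) * lam\<^sup>2 / (2 * \<sigma>\<^sup>2)))"
    by (simp add: q_def \<tau>_def)
  finally show ?thesis .
qed

end
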